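(* Let $k\in\mathbb{N}$ and suppose that the sequence $(\ell_{n,k})_{n\in\mathbb{N}_0}$ is square-summable. Then for every $t\in\mathbb{R}$, $$\zeta^k\!\left(\tfrac12+it\right)=\sum_{n\ge -k}\ell_{n,k}\left(\frac{\frac12-it}{\frac12+it}\right)^n,$$ the series converging (as the limit of its partial sums over $-k\le n\le N$, $N\to\infty$). In particular, if the Lindelöf Hypothesis is true, this expansion holds for every $k\in\mathbb{N}$ and every $t\in\mathbb{R}$.
   Context: $\zeta$ denotes the Riemann zeta function. For $k\in\mathbb{N}$, $\lambda_{j,k}$ ($j\in\mathbb{N}_0$) are defined by $(s-1)^k\zeta^k(s)=\sum_{j\ge0}\frac{\lambda_{j,k}}{j!}(s-1)^j$ for $|s-1|\le1$, and $\ell_{n,k}=(-1)^n\sum_{j=1}^n\binom{n-1}{j-1}\frac{\lambda_{j+k,k}}{(j+k)!}$ for $n\ge1$, $\ell_{n,k}=(-1)^k\sum_{j=0}^{k+n}\binom{k-j}{-n}(-1)^j\frac{\lambda_{j,k}}{j!}$ for $-k\le n\le 0$. The Lindelöf Hypothesis is the statement $\zeta(\frac12+it)=O(|t|^\varepsilon)$ for every $\varepsilon>0$. *)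

theory Defs
  imports "HOL-Complex_Analysis.Complex_Analysis"
begin

text \<open>The Riemann zeta function: the (unique) holomorphic function on the punctured
  plane that agrees with the Dirichlet series for Re s > 1. Its value at s = 1 is irrelevant.\<close>
definition zeta :: "complex \<Rightarrow> complex" where
  "zeta = (SOME f. f holomorphic_on (- {1}) \<and>
      (\<forall>s. Re s > 1 \<longrightarrow> (\<lambda>n. 1 / (of_nat (Suc n)) powr s) sums f s))"

text \<open>Coefficients lambda_{j,k}: (s-1)^k zeta^k(s) = sum_j lambda_{j,k}/j! (s-1)^j for
  |s-1| <= 1 (at s = 1 the left side is understood by continuity, so we require the
  identity for s <> 1).\<close>
definition lam :: "nat \<Rightarrow> nat \<Rightarrow> complex" where
  "lam j k = (THE c :: nat \<Rightarrow> complex. \<forall>s. s \<noteq> 1 \<and> cmod (s - 1) \<le> 1 \<longrightarrow>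
      (\<lambda>i. c i / fact i * (s - 1) ^ i) sums ((s - 1) ^ k * zeta s ^ k)) j"

text \<open>ell_{n,k} for integers n >= -k (set to 0 for n < -k, where it is not used).\<close>
definition ell :: "int \<Rightarrow> nat \<Rightarrow> complex" where
  "ell n k =
    (if n \<ge> 1 then (-1) ^ nat n *
        (\<Sum>j=1..nat n. of_nat ((nat n - 1) choose (j - 1)) * lam (j + k) k / fact (j + k))
     else if - int k \<le> n then (-1) ^ k *
        (\<Sum>j=0..nat (int k + n). of_nat ((k - j) choose nat (- n)) * (-1) ^ j * lam j k / fact j)
     else 0)"

definition lindelof_hypothesis :: bool where
  "lindelof_hypothesis \<longleftrightarrow> (\<forall>\<epsilon>>0. \<exists>C T. \<forall>t::real. \<bar>t\<bar> \<ge> T \<longrightarrow>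
      cmod (zeta (Complex (1/2) t)) \<le> C * \<bar>t\<bar> powr \<epsilon>)"

definition zeta_expansion_holds :: "nat \<Rightarrow> real \<Rightarrow> bool" where
  "zeta_expansion_holds k t \<longleftrightarrow>
    (\<lambda>N::nat. \<Sum>n\<in>{- int k..int N}.
        ell n k * ((Complex (1/2) (- t)) / (Complex (1/2) t)) powi n)
      \<longlonglongrightarrow> zeta (Complex (1/2) t) ^ k"

end

theory Submission
  imports Defs "HOL-Real_Asymp.Real_Asymp"
begin

text \<open>
  The substitution \<open>s = 1 / (1 + z)\<close> maps the unit disc onto the half-plane
  \<open>Re s > 1/2\<close> and sends \<open>0\<close> to \<open>1\<close> and \<open>-1\<close> to
  \<open>\<infinity>\<close>. In the variable \<open>z\<close> the function \<open>z\<^sup>k \<zeta>(s)\<^sup>k\<close> is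
  holomorphic away from \<open>-1\<close>, and its Taylor coefficients at \<open>0\<close> are the
  \<open>\<ell>\<^bsub>n-k,k\<^esub>\<close>. By the theorem of Fatou and M. Riesz the Taylor series converges at
  every regular point of the unit circle as soon as its coefficients tend to zero. This is immediate
  when they are square-summable. Under the Lindelof Hypothesis a Phragmen--Lindelof argument gives
  the bound \<open>O(|1 + z| powr (-1/2))\<close> in the disc, whose boundary values are
  integrable, and a Riemann--Lebesgue argument shows that the coefficients tend to zero.

  The continuation of \<open>\<zeta>\<close> comes from summing the Taylor expansion of
  \<open>x powr (1 - s)\<close> at \<open>n\<close>, evaluated at \<open>n - 1\<close>, over all
  \<open>n \<ge> 2\<close>: the left-hand side telescopes, and the result expresses
  \<open>(s - 1) \<zeta>(s)\<close> by values of \<open>\<zeta>\<close> further to the right and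
  a remainder that converges in a larger half-plane.
\<close>

section \<open>Analytic continuation of the zeta function\<close>

text \<open>The explicit series replaces \<open>zeta\<close> until a continuation is known to exist,
  because \<open>zeta\<close> is a choice among such continuations. It is meaningful only for Re s >
  1.\<close>

definition dirichlet_zeta :: "complex \<Rightarrow> complex" where
  "dirichlet_zeta s = (\<Sum>n. 1 / of_nat (Suc n) powr s)"

text \<open>The remainder after degree \<open>M\<close> of the Taylor expansion of x powr (1 - s) at
  n + 2, evaluated at n + 1. The signs of the derivatives cancel against the powers of the increment
  -1, so rising factorials remain.\<close>

definition powr_remainder :: "nat \<Rightarrow> nat \<Rightarrow> complex \<Rightarrow> complex" where
  "powr_remainder M n s = of_nat (Suc n) powr (1 - s) -
     (\<Sum>i\<le>M. pochhammer (s - 1) i / fact i * of_nat (Suc (Suc n)) powr (1 - s - of_nat i))"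

text \<open>The derivative of order M + 1 has modulus |pochhammer (s - 1) (M + 1)| x powr -(Re s +
  M). By the assumption this is nonincreasing in x, so on the segment from n + 1 to n + 2 it is
  largest at the left end.\<close>

lemma powr_remainder_bound:
  assumes "0 \<le> Re s + real M"
  shows "norm (powr_remainder M n s)
           \<le> norm (pochhammer (s - 1) (Suc M)) * real (Suc n) powr - (Re s + real M)"
proof -
  define S where "S = closed_segment (of_nat (Suc n) :: complex) (of_nat (Suc (Suc n)))"
  define f where "f = (\<lambda>i x. (-1) ^ i * pochhammer (s - 1) i * x powr (1 - s - of_nat i) :: complex)"
  define B where "B = norm (pochhammer (s - 1) (Suc M)) * real (Suc n) powr - (Re s + real M)"
  have S: "\<exists>y. x = of_real y \<and> real (Suc n) \<le> y" if "x \<in> S" for x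
  proof -
    have "x \<in> of_real ` closed_segment (real (Suc n)) (real (Suc (Suc n)))"
      using that unfolding S_def closed_segment_of_real[symmetric] by simp
    then show ?thesis by (auto simp: closed_segment_eq_real_ivl)
  qed
  have "norm (f 0 (of_nat (Suc n)) - (\<Sum>i\<le>M. f i (of_nat (Suc (Suc n))) *
      (of_nat (Suc n) - of_nat (Suc (Suc n))) ^ i / fact i))
     \<le> B * norm (of_nat (Suc n) - of_nat (Suc (Suc n)) :: complex) ^ Suc M / fact M"
  proof (rule complex_Taylor)
    show "convex S" by (simp add: S_def)
    show "of_nat (Suc (Suc n)) \<in> S" "of_nat (Suc n) \<in> S" by (auto simp: S_def)
  next
    fix i x assume "x \<in> S"
    then obtain y where y: "x = of_real y" "real (Suc n) \<le> y" using S by blast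
    then have "x \<notin> \<real>\<^sub>\<le>\<^sub>0" by (auto simp: complex_nonpos_Reals_iff)
    moreover have "1 - s - of_nat i - 1 = 1 - s - of_nat (Suc i)" by simp
    ultimately have "((\<lambda>x. x powr (1 - s - of_nat i)) has_field_derivative
        (1 - s - of_nat i) * x powr (1 - s - of_nat (Suc i))) (at x)"
      by (metis has_field_derivative_powr)
    then have "(f i has_field_derivative (-1) ^ i * pochhammer (s - 1) i *
        ((1 - s - of_nat i) * x powr (1 - s - of_nat (Suc i)))) (at x)"
      unfolding f_def by (rule DERIV_cmult)
    also have "(-1) ^ i * pochhammer (s - 1) i *
        ((1 - s - of_nat i) * x powr (1 - s - of_nat (Suc i))) = f (Suc i) x"
      by (simp add: f_def pochhammer_Suc algebra_simps)
    finally show "(f i has_field_derivative f (Suc i) x) (at x within S)"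
      by (rule has_field_derivative_at_within)
  next
    fix x assume "x \<in> S"
    then obtain y where y: "x = of_real y" "real (Suc n) \<le> y" using S by blast
    have "norm (f (Suc M) x) = norm (pochhammer (s - 1) (Suc M)) * y powr - (Re s + real M)"
      using y by (simp add: f_def norm_mult norm_power norm_powr_real_powr algebra_simps)
    also have "\<dots> \<le> B"
      unfolding B_def using y assms
      by (intro mult_left_mono powr_mono2') auto
    finally show "norm (f (Suc M) x) \<le> B" .
  qed
  also have "f 0 (of_nat (Suc n)) - (\<Sum>i\<le>M. f i (of_nat (Suc (Suc n))) *
      (of_nat (Suc n) - of_nat (Suc (Suc n))) ^ i / fact i) = powr_remainder M n s"
  proof -
    have "f i (of_nat (Suc (Suc n))) * (of_nat (Suc n) - of_nat (Suc (Suc n))) ^ i / fact i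
      = pochhammer (s - 1) i / fact i * of_nat (Suc (Suc n)) powr (1 - s - of_nat i)" for i
    proof -
      have "(-1) ^ i * (-1::complex) ^ i = 1" by (simp flip: power_mult_distrib)
      then show ?thesis by (simp add: f_def)
    qed
    then show ?thesis unfolding powr_remainder_def by (simp only:) (simp add: f_def)
  qed
  also have "norm (of_nat (Suc n) - of_nat (Suc (Suc n)) :: complex) = 1" by simp
  also have "B * 1 ^ Suc M / fact M \<le> B"
  proof -
    have "B * 1 \<le> B * fact M" by (intro mult_left_mono) (auto simp: B_def)
    then show ?thesis by (simp add: divide_le_eq)
  qed
  finally show ?thesis by (simp add: B_def)
qed

section \<open>Summation of the Taylor remainders over n\<close>

lemma summable_Suc_powr: "a > 1 \<Longrightarrow> summable (\<lambda>n. real (Suc n) powr - a)"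
  by (subst summable_Suc_iff) (simp add: summable_real_powr_iff)

lemma norm_Suc_powr: "norm ((of_nat (Suc n) :: complex) powr s) = real (Suc n) powr Re s"
  using norm_powr_real_powr[of "of_nat (Suc n)" s] by simp

lemma dirichlet_zeta_sums:
  assumes "Re s > 1"
  shows "(\<lambda>n. 1 / of_nat (Suc n) powr s) sums dirichlet_zeta s"
proof -
  have "summable (\<lambda>n. 1 / of_nat (Suc n) powr s :: complex)"
  proof (rule summable_comparison_test[OF _ summable_Suc_powr[OF assms]], intro exI allI impI)
    fix n :: nat
    show "norm (1 / of_nat (Suc n) powr s) \<le> real (Suc n) powr - Re s"
      unfolding norm_divide norm_Suc_powr by (simp add: powr_minus field_simps)
  qed
  then show ?thesis unfolding dirichlet_zeta_def by (rule summable_sums)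
qed

text \<open>The i = 0 term of the expansion telescopes to 1. For i >= 1 the bases start at 2, so
  each term sums to a zeta value without its first summand 1.\<close>

lemma powr_remainder_sums:
  assumes "Re s > 1"
  shows "(\<lambda>n. powr_remainder M n s) sums
    (1 - (\<Sum>i=1..M. pochhammer (s - 1) i / fact i * (dirichlet_zeta (s + of_nat i - 1) - 1)))"
proof -
  have "(\<lambda>n. of_nat (Suc n) powr (1 - s) :: complex) \<longlonglongrightarrow> 0"
  proof (rule tendsto_norm_zero_cancel)
    have "(\<lambda>n. real (Suc n) powr (1 - Re s)) \<longlonglongrightarrow> 0"
      using assms by (intro tendsto_neg_powr filterlim_compose[OF filterlim_real_sequentially filterlim_Suc]) auto
    then show "(\<lambda>n. norm (of_nat (Suc n) powr (1 - s) :: complex)) \<longlonglongrightarrow> 0"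
      unfolding norm_Suc_powr by simp
  qed
  from telescope_sums'[OF this]
  have tel: "(\<lambda>n. of_nat (Suc n) powr (1 - s) - of_nat (Suc (Suc n)) powr (1 - s)) sums (1 :: complex)"
    by simp
  have tail: "(\<lambda>n. of_nat (Suc (Suc n)) powr (1 - s - of_nat i)) sums (dirichlet_zeta (s + of_nat i - 1) - 1)"
    if "i \<in> {1..M}" for i
  proof -
    have "Re (s + of_nat i - 1) > 1" using that assms by auto
    from dirichlet_zeta_sums[OF this]
    have "(\<lambda>n. 1 / of_nat (Suc (Suc n)) powr (s + of_nat i - 1)) sums
        (dirichlet_zeta (s + of_nat i - 1) - 1)"
      using sums_split_initial_segment[of _ _ 1] by fastforce
    moreover have "1 / of_nat (Suc (Suc n)) powr (s + of_nat i - 1)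
       = of_nat (Suc (Suc n)) powr (1 - s - of_nat i)" for n
      by (simp add: powr_minus[symmetric] divide_inverse algebra_simps)
    ultimately show ?thesis by simp
  qed
  have "(\<lambda>n. (of_nat (Suc n) powr (1 - s) - of_nat (Suc (Suc n)) powr (1 - s)) -
      (\<Sum>i=1..M. pochhammer (s - 1) i / fact i * of_nat (Suc (Suc n)) powr (1 - s - of_nat i))) sums
     (1 - (\<Sum>i=1..M. pochhammer (s - 1) i / fact i * (dirichlet_zeta (s + of_nat i - 1) - 1)))"
    by (intro sums_diff tel sums_sum sums_mult tail)
  moreover have "(of_nat (Suc n) powr (1 - s) - of_nat (Suc (Suc n)) powr (1 - s)) -
      (\<Sum>i=1..M. pochhammer (s - 1) i / fact i * of_nat (Suc (Suc n)) powr (1 - s - of_nat i))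
    = powr_remainder M n s" for n
    by (simp add: powr_remainder_def atMost_atLeast0 sum.atLeast_Suc_atMost)
  ultimately show ?thesis by simp
qed

lemma powr_remainder_series_holomorphic:
  obtains g where "g holomorphic_on {s. Re s > 1 - real M}"
    and "\<And>s. Re s > 1 - real M \<Longrightarrow> (\<lambda>n. powr_remainder M n s) sums g s"
proof -
  define S where "S = {s. Re s > 1 - real M}"
  have S: "open S" unfolding S_def by (rule open_halfspace_Re_gt)
  obtain g where g: "\<forall>x\<in>S. ((\<lambda>n. powr_remainder M n x) sums g x) \<and> g field_differentiable (at x)"
  proof (rule series_differentiable_comparison_complex[OF S])
    fix n x assume "x \<in> S"
    have "(\<lambda>s. powr_remainder M n s) holomorphic_on UNIV"
      unfolding powr_remainder_def by (intro holomorphic_intros) (auto simp: pochhammer_prod intro!: holomorphic_intros)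
    then show "powr_remainder M n field_differentiable at x"
      by (simp add: holomorphic_on_def)
  next
    fix x assume "x \<in> S"
    \<comment> \<open>Half the distance to the boundary line: the majorant on the ball has exponent
      -(1 + d), hence is summable.\<close>
    define d where "d = (Re x - (1 - real M)) / 2"
    have d: "d > 0" using \<open>x \<in> S\<close> by (simp add: d_def S_def)
    have "bounded ((\<lambda>y. pochhammer (y - 1) (Suc M)) ` cball x d)"
      by (intro compact_imp_bounded compact_continuous_image)
        (auto simp: pochhammer_prod intro!: continuous_intros)
    then obtain K where K: "\<And>y. y \<in> cball x d \<Longrightarrow> norm (pochhammer (y - 1) (Suc M)) \<le> K"
      unfolding bounded_iff by (metis image_eqI)
    have K0: "K \<ge> 0" using order_trans[OF norm_ge_zero K[of x]] d by simp
    define h where "h = (\<lambda>n. complex_of_real (K * real (Suc n) powr - (Re x - d + real M)))"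
    have "summable h"
      unfolding h_def using d
      by (intro summable_of_real summable_mult summable_Suc_powr) (auto simp: d_def field_simps)
    moreover have "range h \<subseteq> \<real>\<^sub>\<ge>\<^sub>0" using K0 by (auto simp: h_def simp del: of_real_mult)
    moreover have "norm (powr_remainder M n y) \<le> norm (h n)" if y: "y \<in> ball x d \<inter> S" for n y
    proof -
      have "\<bar>Re (x - y)\<bar> < d" using y abs_Re_le_cmod[of "x - y"] by (auto simp: dist_norm)
      then have "Re y \<ge> Re x - d" by simp
      moreover have "Re x - d + real M > 1" using d by (simp add: d_def field_simps)
      ultimately have "norm (powr_remainder M n y) \<le> norm (pochhammer (y - 1) (Suc M)) * real (Suc n) powr - (Re y + real M)"
        by (intro powr_remainder_bound) auto
      also have "\<dots> \<le> K * real (Suc n) powr - (Re x - d + real M)"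
        using \<open>Re y \<ge> Re x - d\<close> y K0 by (intro mult_mono K powr_mono) auto
      finally show ?thesis using K0 by (simp add: h_def norm_mult)
    qed
    ultimately show "\<exists>d h. 0 < d \<and> summable h \<and> range h \<subseteq> \<real>\<^sub>\<ge>\<^sub>0 \<and>
        (\<forall>\<^sub>F n in sequentially. \<forall>y\<in>ball x d \<inter> S. norm (powr_remainder M n y) \<le> cmod (h n))"
      using d by (intro exI[of _ d] exI[of _ h]) auto
  qed blast
  show ?thesis
  proof (rule that)
    show "g holomorphic_on {s. Re s > 1 - real M}"
      using g S unfolding S_def[symmetric] by (auto simp: holomorphic_on_open field_differentiable_def)
    show "(\<lambda>n. powr_remainder M n s) sums g s" if "Re s > 1 - real M" for s
      using g that by (auto simp: S_def)
  qed
qed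

text \<open>The factor s - 1 cancels the pole, so that the continuations live on full half-planes,
  which are connected and nested.\<close>

definition xi_continuation :: "nat \<Rightarrow> (complex \<Rightarrow> complex) \<Rightarrow> bool" where
  "xi_continuation M F \<longleftrightarrow> F holomorphic_on {s. Re s > 1 - real M} \<and>
     (\<forall>s. Re s > 1 \<longrightarrow> F s = (s - 1) * dirichlet_zeta s)"

text \<open>For \<open>M\<close> = 1 the summed identity can be solved for (s - 1) zeta(s) without
  further zeta values. The quadratic growth comes from the factor (s - 1) s in the remainder bound;
  it is the a priori bound that the Phragmen--Lindelof argument starts from.\<close>

lemma xi_continuation_base:
  obtains F C where "xi_continuation (Suc 0) F" "C \<ge> 0"
    "\<And>s. Re s \<ge> 1/2 \<Longrightarrow> norm (F s) \<le> C * (1 + norm s)\<^sup>2"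
proof -
  obtain g where g: "g holomorphic_on {s. Re s > 1 - real 1}"
    and sums: "\<And>s. Re s > 1 - real 1 \<Longrightarrow> (\<lambda>n. powr_remainder 1 n s) sums g s"
    using powr_remainder_series_holomorphic[of 1] by metis
  define A where "A = (\<Sum>n. real (Suc n) powr - (3/2))"
  have A: "summable (\<lambda>n. real (Suc n) powr - (3/2))" by (rule summable_Suc_powr) simp
  have A0: "A \<ge> 0" unfolding A_def by (intro suminf_nonneg A) auto
  show ?thesis
  proof (rule that)
    show "xi_continuation (Suc 0) (\<lambda>s. s - g s)"
      unfolding xi_continuation_def
    proof (intro conjI allI impI)
      show "(\<lambda>s. s - g s) holomorphic_on {s. 1 - real (Suc 0) < Re s}"
        using g by (auto intro!: holomorphic_intros)
      fix s assume "Re s > 1"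
      from powr_remainder_sums[OF this, of 1] sums[of s] this
      have "g s = 1 - (s - 1) * (dirichlet_zeta s - 1)"
        by (simp add: sums_iff)
      then show "s - g s = (s - 1) * dirichlet_zeta s" by (simp add: algebra_simps)
    qed
    show "0 \<le> 1 + A" using A0 by simp
    fix s assume s: "Re s \<ge> 1/2"
    have bnd: "norm (powr_remainder 1 n s) \<le> norm ((s - 1) * s) * real (Suc n) powr - (3/2)" for n
    proof -
      have "norm (powr_remainder 1 n s) \<le> norm (pochhammer (s - 1) (Suc 1)) * real (Suc n) powr - (Re s + real 1)"
        using s by (intro powr_remainder_bound) auto
      also have "\<dots> \<le> norm ((s - 1) * s) * real (Suc n) powr - (3/2)"
        using s by (intro mult_mono powr_mono) (auto simp: pochhammer_Suc)
      finally show ?thesis .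
    qed
    have "norm (g s) \<le> norm ((s - 1) * s) * A"
    proof -
      have "g s = (\<Sum>n. powr_remainder 1 n s)" using sums[of s] s by (simp add: sums_iff)
      moreover have "norm (\<Sum>n. powr_remainder 1 n s) \<le> (\<Sum>n. norm ((s - 1) * s) * real (Suc n) powr - (3/2))"
        by (intro norm_suminf_le bnd summable_mult A)
      ultimately show ?thesis unfolding A_def using suminf_mult[OF A] by simp
    qed
    also have "\<dots> = norm (s - 1) * norm s * A" by (simp add: norm_mult)
    also have "\<dots> \<le> (1 + norm s) * (1 + norm s) * A"
      using norm_triangle_ineq4[of s 1] A0 by (intro mult_right_mono mult_mono) auto
    finally have "norm (g s) \<le> (1 + norm s)\<^sup>2 * A" by (simp add: power2_eq_square)
    moreover have "norm s \<le> (1 + norm s)\<^sup>2" by (simp add: power2_eq_square algebra_simps)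
    ultimately show "norm (s - g s) \<le> (1 + A) * (1 + norm s)\<^sup>2"
      using norm_triangle_ineq4[of s "g s"] by (simp add: algebra_simps)
  qed
qed

text \<open>The i = 1 term of the summed identity contains zeta(s) itself. All terms with i >= 2
  contain zeta at s + i - 1, at least one unit to the right, where \<open>F\<close> is already
  available.\<close>

lemma xi_continuation_step:
  assumes "xi_continuation M F"
  shows "\<exists>F. xi_continuation (Suc M) F"
proof -
  obtain g where g: "g holomorphic_on {s. Re s > 1 - real (Suc M)}"
    and sums: "\<And>s. Re s > 1 - real (Suc M) \<Longrightarrow> (\<lambda>n. powr_remainder (Suc M) n s) sums g s"
    using powr_remainder_series_holomorphic[of "Suc M"] by metis
  have F: "F holomorphic_on {s. Re s > 1 - real M}"
    and F_eq: "\<And>s. Re s > 1 \<Longrightarrow> F s = (s - 1) * dirichlet_zeta s"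
    using assms by (auto simp: xi_continuation_def)
  \<comment> \<open>The last factor s + i - 2 of \<open>pochhammer (s - 1) i\<close> turns zeta(s +
    i - 1) into F(s + i - 1), which removes the pole of that term.\<close>
  define G where "G = (\<lambda>s. s - (\<Sum>i=2..Suc M. (pochhammer (s - 1) (i - 1) * F (s + of_nat i - 1)
      - pochhammer (s - 1) i) / fact i) - g s)"
  have "xi_continuation (Suc M) G"
    unfolding xi_continuation_def
  proof (intro conjI allI impI)
    have "(\<lambda>s. F (s + of_nat i - 1)) holomorphic_on {s. Re s > 1 - real (Suc M)}" if "i \<ge> 2" for i
    proof (rule holomorphic_on_compose_gen[OF _ F, unfolded o_def])
      show "(\<lambda>s. s + of_nat i - 1) holomorphic_on {s. Re s > 1 - real (Suc M)}"
        by (intro holomorphic_intros)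
      show "(\<lambda>s. s + of_nat i - 1) ` {s. 1 - real (Suc M) < Re s} \<subseteq> {s. 1 - real M < Re s}"
        using that by auto
    qed
    moreover have "(\<lambda>s. pochhammer (s - 1) i) holomorphic_on A" for i A
      by (auto simp: pochhammer_prod intro!: holomorphic_intros)
    ultimately show "G holomorphic_on {s. Re s > 1 - real (Suc M)}"
      unfolding G_def by (intro holomorphic_intros g) auto
    fix s assume s: "Re s > 1"
    have "g s = 1 - (\<Sum>i=1..Suc M. pochhammer (s - 1) i / fact i * (dirichlet_zeta (s + of_nat i - 1) - 1))"
      using powr_remainder_sums[OF s, of "Suc M"] sums[of s] s by (simp add: sums_iff)
    also have "(\<Sum>i=1..Suc M. pochhammer (s - 1) i / fact i * (dirichlet_zeta (s + of_nat i - 1) - 1))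
      = (s - 1) * (dirichlet_zeta s - 1) +
        (\<Sum>i=2..Suc M. pochhammer (s - 1) i / fact i * (dirichlet_zeta (s + of_nat i - 1) - 1))"
      by (subst sum.atLeast_Suc_atMost) (auto simp: numeral_2_eq_2)
    also have "(\<Sum>i=2..Suc M. pochhammer (s - 1) i / fact i * (dirichlet_zeta (s + of_nat i - 1) - 1))
      = (\<Sum>i=2..Suc M. (pochhammer (s - 1) (i - 1) * F (s + of_nat i - 1) - pochhammer (s - 1) i) / fact i)"
    proof (rule sum.cong[OF refl])
      fix i assume i: "i \<in> {2..Suc M}"
      then obtain j where j: "i = Suc j" "j \<ge> 1" by (cases i) auto
      have "F (s + of_nat i - 1) = (s - 1 + of_nat j) * dirichlet_zeta (s + of_nat i - 1)"
        using s j by (subst F_eq) auto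
      then show "pochhammer (s - 1) i / fact i * (dirichlet_zeta (s + of_nat i - 1) - 1) =
          (pochhammer (s - 1) (i - 1) * F (s + of_nat i - 1) - pochhammer (s - 1) i) / fact i"
        using j by (simp only: pochhammer_Suc) (simp add: field_simps del: fact_Suc)
    qed
    finally show "G s = (s - 1) * dirichlet_zeta s"
      by (simp add: G_def algebra_simps)
  qed
  then show ?thesis by blast
qed

lemma xi_continuation_unique:
  assumes "xi_continuation M F" "xi_continuation N G" "Re s > 1 - real M" "Re s > 1 - real N"
  shows "F s = G s"
proof (rule analytic_continuation_open[where f = F and g = G])
  define S where "S = {s. Re s > 1 - real (min M N)}"
  show "open {s. Re s > 1}" "open S" unfolding S_def by (rule open_halfspace_Re_gt)+
  show "connected S" unfolding S_def by (intro convex_connected convex_halfspace_Re_gt)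
  have "Re 2 > 1" by simp
  then show "{s. Re s > 1} \<noteq> {}" by blast
  show "{s. Re s > 1} \<subseteq> S" by (auto simp: S_def)
  show "F holomorphic_on S" "G holomorphic_on S"
    using assms(1,2) unfolding xi_continuation_def S_def
    by (auto elim!: holomorphic_on_subset)
  show "F s = G s" if "s \<in> {s. Re s > 1}" for s
    using assms(1,2) that by (auto simp: xi_continuation_def)
  show "s \<in> S" using assms by (auto simp: S_def min_def)
qed

lemma entire_xi_exists:
  obtains F C where "F holomorphic_on UNIV" "\<And>s. Re s > 1 \<Longrightarrow> F s = (s - 1) * dirichlet_zeta s"
    "C \<ge> 0" "\<And>s. Re s \<ge> 1/2 \<Longrightarrow> norm (F s) \<le> C * (1 + norm s)\<^sup>2"
proof -
  obtain F1 C where F1: "xi_continuation (Suc 0) F1" "C \<ge> 0"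
    "\<And>s. Re s \<ge> 1/2 \<Longrightarrow> norm (F1 s) \<le> C * (1 + norm s)\<^sup>2"
    using xi_continuation_base by blast
  have "\<exists>F. xi_continuation (Suc M) F" for M
    by (induction M) (use F1 xi_continuation_step in auto)
  then obtain F where F: "\<And>M. xi_continuation (Suc M) (F M)" by metis
  \<comment> \<open>The index only has to be large enough for s to lie in the half-plane of that
    continuation; by uniqueness every admissible index gives the same value.\<close>
  define G where "G = (\<lambda>s. F (nat \<lceil>2 - Re s\<rceil>) s)"
  have G: "G s = f s" if "xi_continuation M f" "Re s > 1 - real M" for f M s
  proof -
    have "1 - real (Suc (nat \<lceil>2 - Re s\<rceil>)) < Re s" by linarith
    with that F show ?thesis unfolding G_def by (blast intro: xi_continuation_unique)
  qed
  have "G holomorphic_on UNIV"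
  proof -
    have "G holomorphic_on {s. Re s > 1 - real (Suc M)}" for M
      using F[of M] G[OF F[of M]] unfolding xi_continuation_def
      by (metis (no_types, lifting) holomorphic_cong mem_Collect_eq)
    then have "G holomorphic_on (\<Union>M. {s. Re s > 1 - real (Suc M)})"
      by (intro holomorphic_on_UN_open open_halfspace_Re_gt) auto
    also have "(\<Union>M. {s. Re s > 1 - real (Suc M)}) = UNIV"
    proof -
      have "\<exists>M. Re s > 1 - real (Suc M)" for s
        using reals_Archimedean2[of "- Re s"] by (simp add: minus_less_iff)
      then show ?thesis by auto
    qed
    finally show ?thesis .
  qed
  moreover have "G s = (s - 1) * dirichlet_zeta s" if "Re s > 1" for s
    using G[OF F1(1), of s] F1(1) that by (auto simp: xi_continuation_def)
  moreover have "norm (G s) \<le> C * (1 + norm s)\<^sup>2" if "Re s \<ge> 1/2" for s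
    using G[OF F1(1), of s] F1(3)[of s] that by auto
  ultimately show ?thesis using that F1(2) by blast
qed

text \<open>The quotient F s / (s - 1) witnesses the existence behind the \<open>SOME\<close> in
  \<open>zeta\<close>, so the chosen function has both defining properties.\<close>

lemma zeta_holomorphic: "zeta holomorphic_on - {1}"
  and zeta_sums: "Re s > 1 \<Longrightarrow> (\<lambda>n. 1 / of_nat (Suc n) powr s) sums zeta s"
proof -
  obtain F where F: "F holomorphic_on UNIV" "\<And>s. Re s > 1 \<Longrightarrow> F s = (s - 1) * dirichlet_zeta s"
    using entire_xi_exists by metis
  have "(\<lambda>s. F s / (s - 1)) holomorphic_on - {1}"
    using F(1) by (intro holomorphic_intros) (auto elim: holomorphic_on_subset)
  moreover have "(\<lambda>n. 1 / of_nat (Suc n) powr s) sums (F s / (s - 1))" if "Re s > 1" for s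
    using dirichlet_zeta_sums[OF that] F(2)[OF that] that by auto
  ultimately have "\<exists>f. f holomorphic_on (- {1}) \<and>
      (\<forall>s. Re s > 1 \<longrightarrow> (\<lambda>n. 1 / (of_nat (Suc n)) powr s) sums f s)" by blast
  from someI_ex[OF this] show "zeta holomorphic_on - {1}"
    "Re s > 1 \<Longrightarrow> (\<lambda>n. 1 / of_nat (Suc n) powr s) sums zeta s"
    unfolding zeta_def by blast+
qed

text \<open>The identity theorem on the connected punctured plane transfers the entire function and
  its growth bound from the Dirichlet series to \<open>zeta\<close>. From here on only this
  \<open>F\<close> is used for analytic arguments near s = 1.\<close>

proposition zeta_pole_removed:
  obtains F C where "F holomorphic_on UNIV" "\<And>s. s \<noteq> 1 \<Longrightarrow> F s = (s - 1) * zeta s"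
    "C \<ge> 0" "\<And>s. Re s \<ge> 1/2 \<Longrightarrow> norm (F s) \<le> C * (1 + norm s)\<^sup>2"
proof -
  obtain F C where F: "F holomorphic_on UNIV" "\<And>s. Re s > 1 \<Longrightarrow> F s = (s - 1) * dirichlet_zeta s"
    and C: "C \<ge> 0" "\<And>s. Re s \<ge> 1/2 \<Longrightarrow> norm (F s) \<le> C * (1 + norm s)\<^sup>2"
    using entire_xi_exists by metis
  have "F s = (s - 1) * zeta s" if "s \<noteq> 1" for s
  proof (rule analytic_continuation_open[where f = F and g = "\<lambda>s. (s - 1) * zeta s"])
    show "open {s. Re s > 1}" by (rule open_halfspace_Re_gt)
    show "open (- {1 :: complex})" by auto
    show "connected (- {1 :: complex})" by (rule connected_punctured_universe) simp
    have "Re 2 > 1" by simp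
    then show "{s. Re s > 1} \<noteq> {}" by blast
    show "{s. Re s > 1} \<subseteq> - {1}" by auto
    show "F holomorphic_on - {1}" using F(1) by (rule holomorphic_on_subset) auto
    show "(\<lambda>s. (s - 1) * zeta s) holomorphic_on - {1}"
      by (intro holomorphic_intros zeta_holomorphic)
    show "F s = (s - 1) * zeta s" if "s \<in> {s. Re s > 1}" for s
      using that F(2)[of s] zeta_sums[of s] dirichlet_zeta_sums[of s] sums_unique2 by auto
    show "s \<in> - {1}" using that by auto
  qed
  with F(1) C show ?thesis using that by blast
qed


section \<open>The theorem of Fatou and M. Riesz\<close>

lemma geometric_weight_bound:
  fixes \<rho> :: real
  assumes "\<rho> \<ge> 1" "p > 0"
  shows "(\<rho> - 1) / \<rho> ^ p \<le> 1 / real p"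
proof -
  have "1 + real p * (\<rho> - 1) \<le> (1 + (\<rho> - 1)) ^ p"
    using assms by (intro Bernoulli_inequality) auto
  then have "real p * (\<rho> - 1) \<le> \<rho> ^ p" by simp
  then show ?thesis using assms by (simp add: field_simps)
qed

text \<open>Inside the disc the normalised remainder is a power series whose coefficients are the a
  m with m > n, so it is dominated by a geometric series with factor e.\<close>

lemma power_series_tail_bound:
  fixes a :: "nat \<Rightarrow> complex"
  assumes "\<And>m. m > n \<Longrightarrow> norm (a m) \<le> e" "(\<lambda>m. a m * z ^ m) sums w" "norm z < 1" "z \<noteq> 0"
  shows "norm ((w - (\<Sum>m\<le>n. a m * z ^ m)) / z ^ Suc n) * (1 - norm z) \<le> e"
proof -
  have "(\<lambda>m. a (m + Suc n) * z ^ (m + Suc n)) sums (w - (\<Sum>m<Suc n. a m * z ^ m))"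
    by (rule sums_split_initial_segment[OF assms(2)])
  then have "(\<lambda>m. a (m + Suc n) * z ^ (m + Suc n) / z ^ Suc n) sums
      ((w - (\<Sum>m<Suc n. a m * z ^ m)) / z ^ Suc n)"
    by (rule sums_divide)
  then have sm: "(\<lambda>m. a (m + Suc n) * z ^ m) sums ((w - (\<Sum>m\<le>n. a m * z ^ m)) / z ^ Suc n)"
    using assms(4) by (simp only: power_add lessThan_Suc_atMost) (simp del: power_Suc)
  have geo: "(\<lambda>m. e * norm z ^ m) sums (e * (1 / (1 - norm z)))"
    by (intro sums_mult geometric_sums) (use assms in auto)
  have "norm (\<Sum>m. a (m + Suc n) * z ^ m) \<le> (\<Sum>m. e * norm z ^ m)"
    using geo by (intro norm_suminf_le sums_summable[OF geo])
      (auto simp: norm_mult norm_power intro!: mult_right_mono assms)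
  then have "norm ((w - (\<Sum>m\<le>n. a m * z ^ m)) / z ^ Suc n) \<le> e / (1 - norm z)"
    using sm geo by (simp add: sums_iff del: power_Suc)
  then show ?thesis using assms(3) by (simp add: pos_le_divide_eq)
qed

text \<open>Outside the disc the coefficients are split at \<open>N\<close>. The small ones
  contribute at most \<open>e\<close> through the finite geometric sum. The first \<open>N\<close>
  contribute at most A N |z|^N, which the division by z^(n+1) makes small by Bernoulli's inequality,
  uniformly in |z|.\<close>

lemma partial_sum_outer_bound:
  fixes a :: "nat \<Rightarrow> complex" and z :: complex
  assumes "\<And>m. norm (a m) \<le> A" "\<And>m. m \<ge> N \<Longrightarrow> norm (a m) \<le> e" "norm z > 1" "n > N"
  shows "norm ((\<Sum>m\<le>n. a m * z ^ m) / z ^ Suc n) * (norm z - 1) \<le> e + A * N / real (n - N)"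
proof -
  define \<rho> where "\<rho> = norm z"
  have \<rho>: "\<rho> > 1" using assms by (simp add: \<rho>_def)
  have A0: "A \<ge> 0" and e0: "e \<ge> 0"
    using assms(1)[of 0] assms(2)[of N] norm_ge_zero order_trans by blast+
  have "norm ((\<Sum>m\<le>n. a m * z ^ m) / z ^ Suc n) = norm (\<Sum>m\<le>n. a m * z ^ m) / \<rho> ^ Suc n"
    by (simp add: norm_divide norm_mult norm_power \<rho>_def)
  also have "norm (\<Sum>m\<le>n. a m * z ^ m) \<le> (\<Sum>m\<le>n. norm (a m) * \<rho> ^ m)"
    by (rule sum_norm_le) (simp add: norm_mult norm_power \<rho>_def)
  also have "\<dots> \<le> (\<Sum>m\<le>n. e * \<rho> ^ m + (if m < N then A * \<rho> ^ N else 0))"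
  proof (rule sum_mono)
    fix m
    show "norm (a m) * \<rho> ^ m \<le> e * \<rho> ^ m + (if m < N then A * \<rho> ^ N else 0)"
    proof (cases "m < N")
      case True
      have "norm (a m) * \<rho> ^ m \<le> A * \<rho> ^ N"
        using True \<rho> A0 by (intro mult_mono assms power_increasing) auto
      then show ?thesis using True e0 \<rho> by (simp add: add_increasing)
    next
      case False
      then show ?thesis using assms(2)[of m] \<rho> by (simp add: mult_right_mono)
    qed
  qed
  also have "\<dots> = e * (\<Sum>m\<le>n. \<rho> ^ m) + N * (A * \<rho> ^ N)"
  proof -
    have "(\<Sum>m\<le>n. if m < N then A * \<rho> ^ N else 0) = (\<Sum>m<N. A * \<rho> ^ N)"
      by (rule sum.mono_neutral_cong_right) (use assms in auto)
    then show ?thesis by (simp add: sum.distrib sum_distrib_left)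
  qed
  finally have "norm ((\<Sum>m\<le>n. a m * z ^ m) / z ^ Suc n) * (\<rho> - 1)
     \<le> (e * (\<Sum>m\<le>n. \<rho> ^ m) + N * (A * \<rho> ^ N)) / \<rho> ^ Suc n * (\<rho> - 1)"
    using \<rho> by (intro mult_right_mono) (simp_all add: divide_right_mono del: power_Suc)
  also have "\<dots> = e * ((\<Sum>m\<le>n. \<rho> ^ m) * (\<rho> - 1)) / \<rho> ^ Suc n + A * N * ((\<rho> - 1) * \<rho> ^ N / \<rho> ^ Suc n)"
    using \<rho> by (simp add: field_simps del: power_Suc)
  also have "(\<Sum>m\<le>n. \<rho> ^ m) * (\<rho> - 1) = \<rho> ^ Suc n - 1"
    using \<rho> by (simp add: power_diff_1_eq lessThan_Suc_atMost mult.commute del: power_Suc)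
  also have "(\<rho> - 1) * \<rho> ^ N / \<rho> ^ Suc n = (\<rho> - 1) / \<rho> ^ (Suc n - N)"
    using \<rho> assms by (simp add: power_diff del: power_Suc)
  also have "e * (\<rho> ^ Suc n - 1) / \<rho> ^ Suc n + A * N * ((\<rho> - 1) / \<rho> ^ (Suc n - N))
      \<le> e + A * N * (1 / real (n - N))"
  proof (intro add_mono mult_left_mono)
    show "e * (\<rho> ^ Suc n - 1) / \<rho> ^ Suc n \<le> e"
      using e0 \<rho> by (simp add: divide_le_eq algebra_simps del: power_Suc)
    have "(\<rho> - 1) / \<rho> ^ (Suc n - N) \<le> 1 / real (Suc n - N)"
      using \<rho> assms by (intro geometric_weight_bound) auto
    also have "\<dots> \<le> 1 / real (n - N)" using assms by (intro divide_left_mono) auto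
    finally show "(\<rho> - 1) / \<rho> ^ (Suc n - N) \<le> 1 / real (n - N)" .
  qed (use A0 in auto)
  finally show ?thesis by (simp add: \<rho>_def)
qed

text \<open>The theorem of Fatou and M. Riesz. The rectangle is the image under the logarithm of
  a truncated sector symmetric about the positive axis; the factors vanishing at the two corners
  on the unit circle absorb the blow-up of the normalised remainder there, so that the maximum
  modulus principle applies.\<close>
theorem fatou_riesz:
  fixes h :: "complex \<Rightarrow> complex" and a :: "nat \<Rightarrow> complex"
  assumes holo: "h holomorphic_on - {-1}"
    and series: "\<And>z. norm z < 1 \<Longrightarrow> (\<lambda>m. a m * z ^ m) sums h z"
    and a0: "a \<longlonglongrightarrow> 0"
    and z0: "norm z0 = 1" "z0 \<noteq> -1"
  shows "(\<lambda>n. \<Sum>m\<le>n. a m * z0 ^ m) \<longlonglongrightarrow> h z0"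
proof -
  define \<theta> where "\<theta> = Arg z0"
  \<comment> \<open>The midpoint of |\<theta>| and pi: the arc between the angles -\<beta> and
    \<beta> contains \<open>z0\<close> in its interior and avoids -1.\<close>
  define \<beta> where "\<beta> = (\<bar>\<theta>\<bar> + pi) / 2"
  define z1 where "z1 = cis \<beta>"
  define z2 where "z2 = cis (- \<beta>)"
  have z0_eq: "z0 = cis \<theta>"
    using rcis_cmod_Arg[of z0] z0 by (simp add: \<theta>_def rcis_def)
  have "\<theta> \<noteq> pi" using z0 z0_eq by auto
  then have \<theta>: "\<bar>\<theta>\<bar> < pi" using Arg_bounded[of z0] by (auto simp: \<theta>_def)
  then have \<beta>: "\<bar>\<theta>\<bar> < \<beta>" "\<beta> < pi" by (auto simp: \<beta>_def)
  have cis_neq: "cis \<theta> \<noteq> cis \<phi>" if "\<bar>\<phi>\<bar> = \<beta>" for \<phi>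
  proof
    assume "cis \<theta> = cis \<phi>"
    then have "sin (\<theta> - \<phi>) = 0" "cos (\<theta> - \<phi>) = 1"
      by (auto simp: cis.ctr complex_eq_iff sin_diff cos_diff simp flip: power2_eq_square)
    then obtain k :: int where "\<theta> - \<phi> = k * (2 * pi)"
      using cos_one_2pi_int by auto
    moreover have "\<bar>\<theta> - \<phi>\<bar> < 2 * pi" using \<theta> \<beta> that by linarith
    ultimately have "\<bar>real_of_int k\<bar> * (2 * pi) < 1 * (2 * pi)" by (simp add: abs_mult)
    then have "\<bar>real_of_int k\<bar> < 1" by (subst (asm) mult_less_cancel_right) auto
    then have "k = 0" by linarith
    then show False using \<open>\<theta> - \<phi> = _\<close> that \<beta> by auto
  qed
  \<comment> \<open>The modulus at \<open>z0\<close> of the factors vanishing at the corners; it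
    must be positive to be divided out at the end.\<close>
  define c where "c = norm (z0 - z1) * norm (z0 - z2)"
  have c: "c > 0" using cis_neq[of \<beta>] cis_neq[of "- \<beta>"] \<beta> by (auto simp: c_def z0_eq z1_def z2_def)
  define S where "S = cbox (Complex (-1) (- \<beta>)) (Complex 1 \<beta>)"
  have S_iff: "w \<in> S \<longleftrightarrow> \<bar>Re w\<bar> \<le> 1 \<and> \<bar>Im w\<bar> \<le> \<beta>" for w
    by (auto simp: S_def in_cbox_complex_iff)
  have exp_neq: "exp w \<noteq> -1" if "w \<in> S" for w
  proof
    assume w: "exp w = -1"
    then have "Im (exp w) = 0" by simp
    then have "sin (Im w) = 0" by (simp add: Im_exp)
    moreover have "\<bar>Im w\<bar> < pi" using that \<beta> by (auto simp: S_iff)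
    ultimately have "Im w = 0" using sin_zero_pi_iff by blast
    then have "Re (exp w) > 0" by (simp add: Re_exp)
    then show False using w by simp
  qed
  have h_cont: "continuous_on S (\<lambda>w. h (exp w))"
    by (rule continuous_on_compose2[OF holomorphic_on_imp_continuous_on[OF holo]])
      (auto intro!: continuous_intros dest: exp_neq[symmetric])
  have "bounded ((\<lambda>w. h (exp w)) ` S)"
    by (rule compact_imp_bounded[OF compact_continuous_image[OF h_cont]]) (simp add: S_def compact_cbox)
  then obtain H where H: "\<And>w. w \<in> S \<Longrightarrow> norm (h (exp w)) \<le> H"
    unfolding bounded_iff by (metis image_eqI)
  obtain A where A: "\<And>m. norm (a m) \<le> A"
    using convergent_imp_Bseq[OF convergentI[OF a0]] by (auto simp: Bseq_def)
  have A0: "A \<ge> 0" using A[of 0] norm_ge_zero order_trans by blast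
  have "(0 :: complex) \<in> S" using \<beta> by (simp add: S_iff)
  then have H0: "H \<ge> 0" using H norm_ge_zero order_trans by blast
  define X where "X = (\<lambda>n z. (h z - (\<Sum>m\<le>n. a m * z ^ m)) / z ^ Suc n)"
  \<comment> \<open>The error outside the disc, from \<open>h\<close> itself and from the first N
    coefficients. For fixed N it tends to 0 as n grows.\<close>
  define \<eta> where "\<eta> = (\<lambda>N n. H / real (Suc n) + A * N / real (n - N))"
  \<comment> \<open>On the horizontal sides of the rectangle the product is at most 4 D, on the
    vertical sides at most 2 D * 16; this gives the constant 32.\<close>
  have main: "norm (h z0 - (\<Sum>m\<le>n. a m * z0 ^ m)) * c \<le> 32 * (\<delta> + \<eta> N n)"
    if N: "\<And>m. m \<ge> N \<Longrightarrow> norm (a m) \<le> \<delta>" and n: "n > N" for \<delta> N n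
  proof -
    define D where "D = \<delta> + \<eta> N n"
    have D0: "D \<ge> 0" and \<eta>0: "\<eta> N n \<ge> 0"
      using order_trans[OF norm_ge_zero N[of N]] H0 A0
      by (auto simp: D_def \<eta>_def intro!: add_nonneg_nonneg)
    have X: "norm (X n (exp w)) * \<bar>norm (exp w) - 1\<bar> \<le> D" if w: "w \<in> S" for w
    proof -
      consider "norm (exp w) < 1" | "norm (exp w) = 1" | "norm (exp w) > 1" by linarith
      then show ?thesis
      proof cases
        case 1
        have "norm (X n (exp w)) * (1 - norm (exp w)) \<le> \<delta>"
          unfolding X_def by (rule power_series_tail_bound) (use 1 series N n in auto)
        then show ?thesis using 1 \<eta>0 by (simp add: D_def)
      next
        case 2
        then show ?thesis using D0 by simp
      next
        case 3
        let ?z = "exp w" and ?S = "\<Sum>m\<le>n. a m * exp w ^ m"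
        have "norm (X n ?z) \<le> norm (h ?z / ?z ^ Suc n) + norm (?S / ?z ^ Suc n)"
          unfolding X_def diff_divide_distrib by (rule norm_triangle_ineq4)
        then have "norm (X n ?z) * (norm ?z - 1)
            \<le> norm (h ?z / ?z ^ Suc n) * (norm ?z - 1) + norm (?S / ?z ^ Suc n) * (norm ?z - 1)"
          using 3 mult_right_mono[of _ _ "norm ?z - 1"] by (simp only: distrib_right[symmetric])
        also have "norm (h ?z / ?z ^ Suc n) * (norm ?z - 1) = norm (h ?z) * ((norm ?z - 1) / norm ?z ^ Suc n)"
          by (simp add: norm_divide norm_power norm_mult)
        also have "\<dots> \<le> H * (1 / real (Suc n))"
          using 3 by (intro mult_mono H w geometric_weight_bound H0) auto
        also have "norm (?S / ?z ^ Suc n) * (norm ?z - 1) \<le> \<delta> + A * N / real (n - N)"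
          by (rule partial_sum_outer_bound) (use 3 A N n in auto)
        finally show ?thesis using 3 by (simp add: D_def \<eta>_def)
      qed
    qed
    have z12: "norm (exp w - z1) \<le> 4" "norm (exp w - z2) \<le> 4" if "w \<in> S" for w
    proof -
      have "norm (exp w) \<le> exp 1" using that by (auto simp: S_iff)
      then have "norm (exp w) \<le> 3" using exp_le by linarith
      then show "norm (exp w - z1) \<le> 4" "norm (exp w - z2) \<le> 4"
        using norm_triangle_ineq4[of "exp w" z1] norm_triangle_ineq4[of "exp w" z2]
        by (auto simp: z1_def z2_def)
    qed
    define W where "W = (\<lambda>w. X n (exp w) * ((exp w - z1) * (exp w - z2)))"
    have "norm (W (\<i> * \<theta>)) \<le> 32 * D"
    proof (rule maximum_modulus_frontier[where S = S and f = W])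
      have "(\<lambda>w. h (exp w)) holomorphic_on S"
        by (rule holomorphic_on_compose_gen[OF _ holo, unfolded o_def])
          (auto intro!: holomorphic_intros dest: exp_neq[symmetric])
      then have "W holomorphic_on S"
        unfolding W_def X_def by (intro holomorphic_intros) auto
      then show "W holomorphic_on interior S" "continuous_on (closure S) W"
        using interior_subset[of S]
        by (auto simp: S_def intro: holomorphic_on_subset holomorphic_on_imp_continuous_on)
      show "bounded S" by (simp add: S_def)
      show "\<i> * \<theta> \<in> S" using \<beta> by (auto simp: S_iff)
      fix w assume "w \<in> frontier S"
      then have w: "w \<in> S" and bd: "\<bar>Re w\<bar> = 1 \<or> \<bar>Im w\<bar> = \<beta>"
        using \<beta> by (auto simp: S_def frontier_cbox in_cbox_complex_iff in_box_complex_iff)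
      have W: "norm (W w) = norm (X n (exp w)) * (norm (exp w - z1) * norm (exp w - z2))"
        by (simp add: W_def norm_mult)
      \<comment> \<open>On a horizontal side exp w lies on the ray through a corner of the unit
        circle, so its distance to that corner is exactly the factor that tames the remainder in
        \<open>X\<close>.\<close>
      have side: "norm (exp w - cis (Im w)) = \<bar>norm (exp w) - 1\<bar>"
      proof -
        have "exp w - cis (Im w) = of_real (norm (exp w) - 1) * cis (Im w)"
          by (subst exp_eq_polar) (simp add: algebra_simps)
        then show ?thesis by (simp only: norm_mult norm_of_real norm_cis mult_1_right)
      qed
      show "norm (W w) \<le> 32 * D"
      proof (cases "\<bar>Im w\<bar> = \<beta>")
        case True
        then consider "Im w = \<beta>" | "Im w = - \<beta>" by linarith
        then have "norm (exp w - z1) * norm (exp w - z2) \<le> \<bar>norm (exp w) - 1\<bar> * 4"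
        proof cases
          case 1
          then have "norm (exp w - z1) = \<bar>norm (exp w) - 1\<bar>" using side by (simp add: z1_def)
          then show ?thesis using z12[OF w] by (simp add: mult_left_mono)
        next
          case 2
          then have "norm (exp w - z2) = \<bar>norm (exp w) - 1\<bar>" using side by (simp add: z2_def)
          then show ?thesis using z12[OF w] by (subst mult.commute) (simp add: mult_left_mono)
        qed
        then have "norm (W w) \<le> norm (X n (exp w)) * (\<bar>norm (exp w) - 1\<bar> * 4)"
          unfolding W by (rule mult_left_mono) simp
        also have "\<dots> \<le> D * 4" using X[OF w] by (simp add: mult.assoc[symmetric])
        finally show ?thesis using D0 by simp
      next
        case False
        with bd have "\<bar>Re w\<bar> = 1" by blast
        then consider "Re w = 1" | "Re w = - 1" by linarith
        then have "\<bar>norm (exp w) - 1\<bar> \<ge> 1/2"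
        proof cases
          case 1
          then show ?thesis using exp_ge_add_one_self[of "1::real"] by simp
        next
          case 2
          have "exp (-1::real) \<le> 1/2"
            using exp_ge_add_one_self[of "1::real"] by (simp add: exp_minus field_simps)
          with 2 show ?thesis by simp
        qed
        then have "norm (X n (exp w)) * (1/2) \<le> norm (X n (exp w)) * \<bar>norm (exp w) - 1\<bar>"
          by (intro mult_left_mono) auto
        then have "norm (X n (exp w)) \<le> 2 * D" using X[OF w] by simp
        moreover have "norm (exp w - z1) * norm (exp w - z2) \<le> 4 * 4"
          using z12[OF w] by (intro mult_mono) auto
        ultimately have "norm (W w) \<le> 2 * D * (4 * 4)"
          unfolding W by (rule mult_mono) (use D0 in auto)
        then show ?thesis by simp
      qed
    qed
    moreover have "exp (\<i> * \<theta>) = z0" by (simp add: z0_eq cis_conv_exp)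
    ultimately show ?thesis
      using z0 by (simp add: W_def X_def norm_mult norm_divide norm_power c_def D_def)
  qed
  show ?thesis
  proof (rule LIMSEQ_I)
    fix r :: real assume r: "r > 0"
    \<comment> \<open>Chosen so that 32 (\<delta> + \<delta>) = r c.\<close>
    define \<delta> where "\<delta> = r * c / 64"
    have \<delta>: "\<delta> > 0" using r c by (simp add: \<delta>_def)
    obtain N where N: "\<And>m. m \<ge> N \<Longrightarrow> norm (a m) \<le> \<delta>"
      using LIMSEQ_D[OF a0 \<delta>] by (auto intro: less_imp_le)
    have "\<eta> N \<longlonglongrightarrow> 0" unfolding \<eta>_def by real_asymp
    from LIMSEQ_D[OF this \<delta>] obtain M where M: "\<And>n. n \<ge> M \<Longrightarrow> \<eta> N n < \<delta>" by force
    have "norm ((\<Sum>m\<le>n. a m * z0 ^ m) - h z0) < r" if "n \<ge> max M (Suc N)" for n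
    proof -
      have "norm (h z0 - (\<Sum>m\<le>n. a m * z0 ^ m)) * c \<le> 32 * (\<delta> + \<eta> N n)"
        using main[OF N] that by auto
      also have "\<dots> < 32 * (\<delta> + \<delta>)" using M[of n] that by simp
      also have "\<dots> = r * c" by (simp add: \<delta>_def)
      finally show ?thesis using c by (simp add: norm_minus_commute)
    qed
    then show "\<exists>no. \<forall>n\<ge>no. norm ((\<Sum>m\<le>n. a m * z0 ^ m) - h z0) < r" by blast
  qed
qed


section \<open>The Moebius transform of the zeta function\<close>

text \<open>Resolves the \<open>THE\<close> in \<open>lam\<close>. A sequence exists since F (1 + x)
  ^ k is entire, so that its Taylor series converges on the closed unit disc. It is unique because
  any admissible sequence is a power series expansion of the same function at 0.\<close>

lemma lam_eq_fps_nth: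
  assumes F: "F holomorphic_on UNIV" "\<And>s. s \<noteq> 1 \<Longrightarrow> F s = (s - 1) * zeta s"
  shows "lam j k / fact j = fps_nth (fps_expansion (\<lambda>x. F (1 + x) ^ k) 0) j"
proof -
  define g where "g = (\<lambda>x. F (1 + x) ^ k)"
  define P where "P = fps_expansion g 0"
  have g: "g holomorphic_on UNIV"
    unfolding g_def
    by (intro holomorphic_intros holomorphic_on_compose_gen[OF _ F(1), unfolded o_def]) auto
  have P: "g has_fps_expansion P"
    unfolding P_def by (rule has_fps_expansion_fps_expansion[OF _ _ g]) auto
  have P_sums: "(\<lambda>n. fps_nth P n * x ^ n) sums g x" for x
    by (rule has_fps_expansion_imp_sums_complex[OF P, of \<infinity>]) (use g in auto)
  have g_eq: "g (s - 1) = (s - 1) ^ k * zeta s ^ k" if "s \<noteq> 1" for s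
    using F(2)[OF that] by (simp add: g_def power_mult_distrib)
  define Q where "Q = (\<lambda>c :: nat \<Rightarrow> complex. \<forall>s. s \<noteq> 1 \<and> norm (s - 1) \<le> 1 \<longrightarrow>
      (\<lambda>i. c i / fact i * (s - 1) ^ i) sums ((s - 1) ^ k * zeta s ^ k))"
  have "(THE c. Q c) = (\<lambda>i. fps_nth P i * fact i)"
  proof (rule the_equality)
    show "Q (\<lambda>i. fps_nth P i * fact i)"
      unfolding Q_def
    proof (intro allI impI)
      fix s :: complex assume "s \<noteq> 1 \<and> norm (s - 1) \<le> 1"
      then show "(\<lambda>i. fps_nth P i * fact i / fact i * (s - 1) ^ i) sums ((s - 1) ^ k * zeta s ^ k)"
        using P_sums[of "s - 1"] g_eq[of s] by simp
    qed
  next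
    fix c assume "Q c"
    have sm: "(\<lambda>i. c i / fact i * x ^ i) sums g x" if "x \<noteq> 0" "norm x < 1" for x
    proof -
      have "(\<lambda>i. c i / fact i * (1 + x - 1) ^ i) sums ((1 + x - 1) ^ k * zeta (1 + x) ^ k)"
        using \<open>Q c\<close> that unfolding Q_def by (metis add_cancel_left_right add_diff_cancel_left' less_imp_le)
      then show ?thesis using g_eq[of "1 + x"] that by simp
    qed
    \<comment> \<open>The defining identity omits s = 1, so the constant coefficient is recovered as
      a limit.\<close>
    have "(g \<longlongrightarrow> c 0 / fact 0) (at 0)"
      using powser_limit_0_strong[of 1 "\<lambda>i. c i / fact i" g] sm by simp
    moreover have "(g \<longlongrightarrow> g 0) (at 0)"
      using holomorphic_on_imp_continuous_on[OF g] by (simp add: continuous_on_def)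
    ultimately have "g 0 = c 0 / fact 0" using tendsto_unique[OF at_neq_bot] by blast
    then have sm': "(\<lambda>i. c i / fact i * x ^ i) sums g x" if "norm x < 1" for x
      using sm[of x] that powser_sums_zero[of "\<lambda>i. c i / fact i"] by (cases "x = 0") auto
    have "g has_fps_expansion Abs_fps (\<lambda>i. c i / fact i)"
    proof (rule has_fps_expansionI)
      have "eventually (\<lambda>x::complex. x \<in> ball 0 1) (nhds 0)"
        by (rule eventually_nhds_in_open) auto
      then show "\<forall>\<^sub>F u in nhds 0. (\<lambda>n. fps_nth (Abs_fps (\<lambda>i. c i / fact i)) n * u ^ n) sums g u"
        by eventually_elim (use sm' in auto)
    qed
    then have "Abs_fps (\<lambda>i. c i / fact i) = P" using P fps_expansion_unique_complex by blast
    then show "c = (\<lambda>i. fps_nth P i * fact i)" by (auto simp: fps_eq_iff fun_eq_iff field_simps)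
  qed
  then have "lam j k = fps_nth P j * fact j" by (simp add: lam_def Q_def)
  then show ?thesis by (simp add: P_def g_def)
qed

text \<open>\<open>G\<close> is the series of -z / (1 + z), which is s - 1 in terms of z. Its i-th
  power is (-1)^i X^i (1 + X)^(-i), and the factor (1 + X)^k turns this into a binomial series with
  exponent k - i, possibly negative.\<close>

lemma fps_moebius_compose_nth:
  fixes P :: "complex fps"
  defines "G \<equiv> - fps_X * fps_binomial (-1)"
  shows "fps_nth ((1 + fps_X) ^ k * fps_compose P G) n =
    (\<Sum>i\<le>n. fps_nth P i * (-1) ^ i * ((of_nat k - of_nat i) gchoose (n - i)))"
proof -
  have G_pow: "G ^ i = fps_const ((-1) ^ i) * (fps_X ^ i * fps_binomial (- of_nat i))" for i
  proof -
    have "G ^ i = (-1) ^ i * (fps_X ^ i * fps_binomial (-1) ^ i)"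
      unfolding G_def mult_minus_left by (subst power_minus) (simp add: power_mult_distrib)
    also have "(-1 :: complex fps) ^ i = fps_const ((-1) ^ i)"
      by (simp flip: fps_const_power fps_const_neg)
    finally show ?thesis by (simp add: fps_binomial_power)
  qed
  have zero: "fps_nth (G ^ i) m = 0" if "m < i" for i m
    using that by (simp add: G_pow fps_X_power_mult_nth)
  have "fps_nth ((1 + fps_X) ^ k * fps_compose P G) n
      = (\<Sum>m=0..n. fps_nth ((1 + fps_X) ^ k) m * (\<Sum>i=0..n - m. fps_nth P i * fps_nth (G ^ i) (n - m)))"
    by (simp add: fps_mult_nth fps_compose_nth)
  also have "\<dots> = (\<Sum>m=0..n. \<Sum>i\<le>n. fps_nth P i * (fps_nth ((1 + fps_X) ^ k) m * fps_nth (G ^ i) (n - m)))"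
  proof (rule sum.cong[OF refl])
    fix m assume "m \<in> {0..n}"
    have "(\<Sum>i=0..n - m. fps_nth P i * fps_nth (G ^ i) (n - m)) = (\<Sum>i\<le>n. fps_nth P i * fps_nth (G ^ i) (n - m))"
      by (rule sum.mono_neutral_left) (auto simp: zero)
    then show "fps_nth ((1 + fps_X) ^ k) m * (\<Sum>i=0..n - m. fps_nth P i * fps_nth (G ^ i) (n - m))
      = (\<Sum>i\<le>n. fps_nth P i * (fps_nth ((1 + fps_X) ^ k) m * fps_nth (G ^ i) (n - m)))"
      by (simp add: sum_distrib_left mult_ac)
  qed
  also have "\<dots> = (\<Sum>i\<le>n. fps_nth P i * fps_nth ((1 + fps_X) ^ k * G ^ i) n)"
    by (subst sum.swap) (simp add: fps_mult_nth sum_distrib_left)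
  also have "\<dots> = (\<Sum>i\<le>n. fps_nth P i * (-1) ^ i * ((of_nat k - of_nat i) gchoose (n - i)))"
  proof (rule sum.cong[OF refl])
    fix i assume i: "i \<in> {..n}"
    have "(1 + fps_X) ^ k * G ^ i = fps_const ((-1) ^ i) * (fps_X ^ i * fps_binomial (of_nat k - of_nat i))"
      using fps_binomial_add_mult[of "of_nat k" "- of_nat i :: complex"]
      by (simp add: G_pow fps_binomial_of_nat mult_ac)
    then show "fps_nth P i * fps_nth ((1 + fps_X) ^ k * G ^ i) n
      = fps_nth P i * (-1) ^ i * ((of_nat k - of_nat i) gchoose (n - i))"
      using i by (simp add: fps_X_power_mult_nth)
  qed
  finally show ?thesis .
qed

text \<open>Generalised binomial coefficients unify the two cases of \<open>ell\<close>. For n <= k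
  they are ordinary ones, rewritten by symmetry. For n > k the terms with i <= k vanish, and the
  others have a negative upper index, which is reflected to an ordinary binomial
  coefficient.\<close>

lemma ell_eq_binomial_sum:
  "ell (int n - int k) k =
    (-1) ^ k * (\<Sum>i\<le>n. lam i k / fact i * (-1) ^ i * ((of_nat k - of_nat i) gchoose (n - i)))"
proof (cases "n \<le> k")
  case True
  have "ell (int n - int k) k = (-1) ^ k *
        (\<Sum>j=0..n. of_nat ((k - j) choose (k - n)) * (-1) ^ j * lam j k / fact j)"
    using True by (auto simp: ell_def nat_diff_distrib)
  also have "(\<Sum>j=0..n. of_nat ((k - j) choose (k - n)) * (-1) ^ j * lam j k / fact j)
     = (\<Sum>i\<le>n. lam i k / fact i * (-1) ^ i * ((of_nat k - of_nat i) gchoose (n - i)))"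
  proof (rule sum.cong)
    fix i assume i: "i \<in> {..n}"
    have "(k - i) choose (k - n) = (k - i) choose (n - i)"
      using binomial_symmetric[of "k - n" "k - i"] True i by simp
    moreover have "(of_nat k - of_nat i :: complex) = of_nat (k - i)"
      using True i by (simp add: of_nat_diff)
    ultimately show "of_nat ((k - i) choose (k - n)) * (-1) ^ i * lam i k / fact i =
        lam i k / fact i * (-1) ^ i * ((of_nat k - of_nat i) gchoose (n - i))"
      by (simp add: binomial_gbinomial)
  qed auto
  finally show ?thesis .
next
  case False
  define N where "N = n - k"
  have N: "n = k + N" "N \<ge> 1" using False by (auto simp: N_def)
  have "(-1) ^ k * (\<Sum>i\<le>n. lam i k / fact i * (-1) ^ i * ((of_nat k - of_nat i :: complex) gchoose (n - i)))
     = (-1) ^ k * (\<Sum>i\<in>{k+1..k+N}. lam i k / fact i * (-1) ^ i * ((of_nat k - of_nat i) gchoose (n - i)))"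
  proof (intro arg_cong[where f = "\<lambda>x. (-1) ^ k * x"] sum.mono_neutral_right ballI)
    fix i assume "i \<in> {..n} - {k+1..k+N}"
    then have i: "i \<le> k" using N by auto
    then have "((of_nat k - of_nat i :: complex) gchoose (n - i)) = of_nat ((k - i) choose (n - i))"
      by (simp add: binomial_gbinomial of_nat_diff)
    also have "(k - i) choose (n - i) = 0" using i N by (intro binomial_eq_0) auto
    finally show "lam i k / fact i * (-1) ^ i * ((of_nat k - of_nat i :: complex) gchoose (n - i)) = 0"
      by simp
  qed (use N in auto)
  also have "\<dots> = (-1) ^ k * (\<Sum>j=1..N. lam (j + k) k / fact (j + k) * (-1) ^ (j + k) *
      ((of_nat k - of_nat (j + k)) gchoose (n - (j + k))))"
    by (subst sum.shift_bounds_cl_nat_ivl[symmetric]) (simp add: add.commute)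
  also have "\<dots> = (\<Sum>j=1..N. (-1) ^ N * (of_nat ((N - 1) choose (j - 1)) * lam (j + k) k / fact (j + k)))"
    unfolding sum_distrib_left
  proof (rule sum.cong[OF refl])
    fix j assume j: "j \<in> {1..N}"
    have "(of_nat k - of_nat (j + k) :: complex) = - of_nat j" by simp
    moreover have "n - (j + k) = N - j" using N by simp
    moreover have "(- of_nat j :: complex) gchoose (N - j) = (-1) ^ (N - j) * of_nat ((N - 1) choose (j - 1))"
    proof -
      have "(- of_nat j :: complex) gchoose (N - j) = (-1) ^ (N - j) * ((of_nat j + of_nat (N - j) - 1) gchoose (N - j))"
        by (rule gbinomial_minus)
      also have "(of_nat j + of_nat (N - j) - 1 :: complex) = of_nat (N - 1)"
        using j by (simp add: of_nat_diff)
      also have "(of_nat (N - 1) :: complex) gchoose (N - j) = of_nat ((N - 1) choose (N - j))"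
        by (simp add: binomial_gbinomial)
      also have "(N - 1) choose (N - j) = (N - 1) choose (j - 1)"
        using binomial_symmetric[of "j - 1" "N - 1"] j by (auto simp: diff_le_mono)
      finally show ?thesis .
    qed
    moreover have "(-1) ^ k * ((-1) ^ (j + k) * (-1) ^ (N - j)) = (-1 :: complex) ^ N"
    proof -
      have "(-1) ^ k * ((-1) ^ (j + k) * (-1) ^ (N - j)) = ((-1) ^ k * (-1) ^ k) * (-1 :: complex) ^ N"
        using j by (simp only: power_add[symmetric]) (simp add: add_ac)
      also have "(-1) ^ k * (-1) ^ k = (1 :: complex)" by (simp flip: power_mult_distrib)
      finally show ?thesis by simp
    qed
    ultimately show "(-1) ^ k * (lam (j + k) k / fact (j + k) * (-1) ^ (j + k) *
        ((of_nat k - of_nat (j + k)) gchoose (n - (j + k))))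
      = (-1) ^ N * (of_nat ((N - 1) choose (j - 1)) * lam (j + k) k / fact (j + k))"
      by (simp add: mult_ac del: of_nat_add fact_Suc)
  qed
  also have "\<dots> = ell (int n - int k) k"
    using N by (simp add: ell_def sum_distrib_left)
  finally show ?thesis by simp
qed

text \<open>With F s = (s - 1) zeta s and s = 1 / (1 + z) this is (z zeta(s))^k, except at z = 0 and
  z = -1; the form with \<open>F\<close> is also holomorphic at z = 0.\<close>

definition disc_function :: "(complex \<Rightarrow> complex) \<Rightarrow> nat \<Rightarrow> complex \<Rightarrow> complex" where
  "disc_function F k z = (- (1 + z) * F (1 / (1 + z))) ^ k"

lemma disc_function_holomorphic:
  assumes "F holomorphic_on UNIV"
  shows "disc_function F k holomorphic_on - {-1}"
  unfolding disc_function_def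
  by (intro holomorphic_intros holomorphic_on_compose_gen[OF _ assms, unfolded o_def])
    (auto simp: add_eq_0_iff)

text \<open>Near 0 the function is (-1)^k (1 + z)^k g(-z / (1 + z)), so its series is a composition
  of formal power series whose coefficients are known.\<close>

lemma disc_function_has_fps_expansion:
  assumes F: "F holomorphic_on UNIV" "\<And>s. s \<noteq> 1 \<Longrightarrow> F s = (s - 1) * zeta s"
  shows "disc_function F k has_fps_expansion Abs_fps (\<lambda>n. ell (int n - int k) k)"
proof -
  define g where "g = (\<lambda>x. F (1 + x) ^ k)"
  define P where "P = fps_expansion g 0"
  have g: "g holomorphic_on UNIV"
    unfolding g_def
    by (intro holomorphic_intros holomorphic_on_compose_gen[OF _ F(1), unfolded o_def]) auto
  have P: "g has_fps_expansion P"
    unfolding P_def by (rule has_fps_expansion_fps_expansion[OF _ _ g]) auto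
  define G :: "complex fps" where "G = - fps_X * fps_binomial (-1)"
  have "(\<lambda>z::complex. - z * inverse (1 + z)) has_fps_expansion G"
    unfolding G_def fps_binomial_minus_one by (intro fps_expansion_intros) auto
  then have "(g \<circ> (\<lambda>z. - z * inverse (1 + z))) has_fps_expansion fps_compose P G"
    by (intro has_fps_expansion_compose P) (auto simp: G_def)
  then have "(\<lambda>z. (-1) ^ k * ((1 + z) ^ k * (g \<circ> (\<lambda>z. - z * inverse (1 + z))) z)) has_fps_expansion
      fps_const ((-1) ^ k) * ((1 + fps_X) ^ k * fps_compose P G)"
    by (intro has_fps_expansion_mult has_fps_expansion_power has_fps_expansion_add
        has_fps_expansion_const has_fps_expansion_1 has_fps_expansion_fps_X)
  also have "fps_const ((-1) ^ k) * ((1 + fps_X) ^ k * fps_compose P G) = Abs_fps (\<lambda>n. ell (int n - int k) k)"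
  proof (rule fps_ext)
    fix n
    show "fps_nth (fps_const ((-1) ^ k) * ((1 + fps_X) ^ k * fps_compose P G)) n =
        fps_nth (Abs_fps (\<lambda>n. ell (int n - int k) k)) n"
      unfolding fps_mult_left_const_nth G_def fps_moebius_compose_nth
      by (simp add: ell_eq_binomial_sum lam_eq_fps_nth[OF F] P_def g_def)
  qed
  finally have exp: "(\<lambda>z. (-1) ^ k * ((1 + z) ^ k * (g \<circ> (\<lambda>z. - z * inverse (1 + z))) z)) has_fps_expansion
      Abs_fps (\<lambda>n. ell (int n - int k) k)" .
  have "eventually (\<lambda>z::complex. z \<in> ball 0 1) (nhds 0)"
    by (rule eventually_nhds_in_open) auto
  then have "eventually (\<lambda>z. (-1) ^ k * ((1 + z) ^ k * (g \<circ> (\<lambda>z. - z * inverse (1 + z))) z)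
      = disc_function F k z) (nhds 0)"
  proof eventually_elim
    case (elim z)
    then have "1 + z \<noteq> 0" by (auto simp: add_eq_0_iff)
    then have "1 + - z * inverse (1 + z) = 1 / (1 + z)" by (simp add: field_simps)
    moreover have "(- (1 + z)) ^ k = (-1) ^ k * (1 + z) ^ k" by (rule power_minus)
    ultimately show ?case
      unfolding disc_function_def g_def o_def power_mult_distrib by simp
  qed
  with exp show ?thesis by (simp add: has_fps_expansion_cong)
qed

lemma disc_function_sums:
  assumes F: "F holomorphic_on UNIV" "\<And>s. s \<noteq> 1 \<Longrightarrow> F s = (s - 1) * zeta s" and "norm z < 1"
  shows "(\<lambda>n. ell (int n - int k) k * z ^ n) sums disc_function F k z"
proof -
  have "disc_function F k holomorphic_on eball 0 1"
    by (rule holomorphic_on_subset[OF disc_function_holomorphic[OF F(1)]]) auto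
  then show ?thesis
    using has_fps_expansion_imp_sums_complex[OF disc_function_has_fps_expansion[OF F]] assms(3) by simp
qed


section \<open>A Phragmen--Lindelof principle\<close>

text \<open>Phragmen--Lindelof: since \<open>Re (1 + z) \<ge> 0\<close> on the disc, the damping factor
  \<open>((1 + z) / (1 + z + \<eta>))\<^sup>M\<close> has modulus at most one while killing the
  polynomial blow-up at \<open>-1\<close>.\<close>
lemma phragmen_lindelof_disc:
  fixes q :: "complex \<Rightarrow> complex"
  assumes holo: "q holomorphic_on - {-1}"
    and growth: "\<And>z. norm z \<le> 1 \<Longrightarrow> z \<noteq> -1 \<Longrightarrow> norm (q z) * norm (1 + z) ^ M \<le> K"
    and bd: "\<And>z. norm z = 1 \<Longrightarrow> z \<noteq> -1 \<Longrightarrow> norm (q z) \<le> B" and "B \<ge> 0"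
    and z: "norm z \<le> 1" "z \<noteq> -1"
  shows "norm (q z) \<le> B"
proof -
  \<comment> \<open>Since Re (1 + u) >= 0, adding \<eta> > 0 moves the point away from the
    origin.\<close>
  have le: "norm (1 + u) \<le> norm (1 + u + of_real \<eta>)" "\<eta> \<le> norm (1 + u + of_real \<eta>)"
    if "norm u \<le> 1" "\<eta> > 0" for u :: complex and \<eta> :: real
  proof -
    have "Re u \<ge> -1" using that abs_Re_le_cmod[of u] by linarith
    then have "\<bar>Re (1 + u)\<bar> \<le> \<bar>Re (1 + u + of_real \<eta>)\<bar>" and re: "\<eta> \<le> Re (1 + u + of_real \<eta>)"
      using that by auto
    then show "norm (1 + u) \<le> norm (1 + u + of_real \<eta>)"
      unfolding cmod_def by (intro real_sqrt_le_mono add_mono) (auto simp: abs_le_square_iff)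
    show "\<eta> \<le> norm (1 + u + of_real \<eta>)"
      using re complex_Re_le_cmod order_trans by blast
  qed
  have main: "norm (q z) * norm (1 + z) ^ Suc M \<le> B * norm (1 + z + of_real \<eta>) ^ Suc M"
    if \<eta>: "\<eta> > 0" for \<eta> :: real
  proof -
    \<comment> \<open>One power more than the growth exponent makes \<open>p\<close> tend to 0 at
      -1, where its value is 0 as well. Thus \<open>p\<close> is continuous on the closed
      disc.\<close>
    define p where "p = (\<lambda>u. q u * (1 + u) ^ Suc M / (1 + u + of_real \<eta>) ^ Suc M)"
    have nz: "1 + u + of_real \<eta> \<noteq> 0" if "norm u \<le> 1" for u :: complex
      using le(2)[OF that \<eta>] \<eta> by auto
    have p_holo: "p holomorphic_on cball 0 1 - {-1}"
      unfolding p_def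
      by (intro holomorphic_intros holomorphic_on_subset[OF holo]) (use nz in auto)
    have p_lim: "norm (p u) \<le> K / \<eta> ^ Suc M * norm (1 + u)" if "norm u \<le> 1" for u
    proof (cases "u = -1")
      case True
      then show ?thesis by (simp add: p_def)
    next
      case False
      have "norm (p u) = norm (q u) * norm (1 + u) ^ M * norm (1 + u) / norm (1 + u + of_real \<eta>) ^ Suc M"
        by (simp add: p_def norm_mult norm_divide norm_power)
      also have "\<dots> \<le> K * norm (1 + u) / \<eta> ^ Suc M"
        using growth[OF that False] le(2)[OF that \<eta>] \<eta>
        by (intro frac_le mult_right_mono power_mono mult_nonneg_nonneg zero_less_power)
          (auto intro: order_trans[OF _ growth[OF that False]])
      finally show ?thesis by simp
    qed
    have "norm (p z) \<le> B"
    proof (rule maximum_modulus_frontier[where S = "cball 0 1" and f = p])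
      show "p holomorphic_on interior (cball 0 1)"
        by (rule holomorphic_on_subset[OF p_holo]) auto
      show "continuous_on (closure (cball 0 1)) p"
      proof -
        have "continuous (at u within cball 0 1) p" if u: "u \<in> cball 0 1" for u
        proof (cases "u = -1")
          case True
          have "((\<lambda>u::complex. K / \<eta> ^ Suc M * norm (1 + u)) \<longlongrightarrow> K / \<eta> ^ Suc M * norm (1 + (-1 :: complex)))
              (at (-1) within cball 0 1)"
            by (intro tendsto_intros)
          then have "((\<lambda>u::complex. K / \<eta> ^ Suc M * norm (1 + u)) \<longlongrightarrow> 0) (at (-1) within cball 0 1)"
            by simp
          moreover have "\<forall>\<^sub>F u in at (-1) within cball 0 1. norm (p u) \<le> K / \<eta> ^ Suc M * norm (1 + u)"
            unfolding eventually_at_filter using p_lim by (auto intro!: always_eventually)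
          ultimately have "(p \<longlongrightarrow> 0) (at (-1) within cball 0 1)"
            by (rule Lim_null_comparison[rotated])
          then show ?thesis using True by (simp add: continuous_within p_def)
        next
          case False
          have "continuous (at u within cball 0 1 - {-1}) p"
            using holomorphic_on_imp_continuous_on[OF p_holo] u False
            by (simp add: continuous_on_eq_continuous_within)
          moreover have "at u within cball 0 1 - {-1} = at u within cball 0 1"
            by (rule at_within_nhd[of _ "- {-1}"]) (use False in auto)
          ultimately show ?thesis by simp
        qed
        then show ?thesis by (simp add: continuous_on_eq_continuous_within)
      qed
      show "bounded (cball 0 1 :: complex set)" "z \<in> cball 0 1" using z by auto
      fix u :: complex assume "u \<in> frontier (cball 0 1)"
      then have u: "norm u = 1" by simp
      show "norm (p u) \<le> B"
      proof (cases "u = -1")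
        case True
        then show ?thesis using \<open>B \<ge> 0\<close> by (simp add: p_def)
      next
        case False
        have "norm (p u) = norm (q u) * (norm (1 + u) ^ Suc M / norm (1 + u + of_real \<eta>) ^ Suc M)"
          by (simp add: p_def norm_mult norm_divide norm_power)
        also have "\<dots> \<le> B * 1"
        proof (intro mult_mono bd u False \<open>B \<ge> 0\<close>)
          show "norm (1 + u) ^ Suc M / norm (1 + u + of_real \<eta>) ^ Suc M \<le> 1"
            using le(1)[of u \<eta>] u \<eta> by (intro divide_le_eq_1[THEN iffD2] disjI1 conjI power_mono)
               (auto intro: power_mono simp del: power_Suc simp: nz)
        qed auto
        finally show ?thesis by simp
      qed
    qed
    then show ?thesis
      using nz[OF z(1)]
      by (simp add: p_def norm_mult norm_divide norm_power divide_le_eq del: power_Suc)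
  qed
  \<comment> \<open>As \<eta> tends to 0 the damping factor tends to 1 for fixed z.\<close>
  have "((\<lambda>\<eta>. B * norm (1 + z + of_real \<eta>) ^ Suc M) \<longlongrightarrow> B * norm (1 + z + of_real 0) ^ Suc M) (at_right 0)"
    by (intro tendsto_intros)
  moreover have "\<forall>\<^sub>F \<eta> in at_right 0. norm (q z) * norm (1 + z) ^ Suc M \<le> B * norm (1 + z + of_real \<eta>) ^ Suc M"
    using main by (auto simp: eventually_at_right_field intro!: exI[of _ 1])
  ultimately have "norm (q z) * norm (1 + z) ^ Suc M \<le> B * norm (1 + z + of_real 0) ^ Suc M"
    by (intro tendsto_lowerbound) auto
  moreover have "1 + z \<noteq> 0" using z(2) by (auto simp: add_eq_0_iff)
  ultimately show ?thesis by (simp del: power_Suc)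
qed


section \<open>Decay of Taylor coefficients\<close>

lemma sin_lower_bound:
  fixes y :: real
  assumes "0 \<le> y" "y \<le> pi / 2"
  shows "y / 4 \<le> sin y"
proof (cases "y \<le> pi / 3")
  case True
  have "sin 0 - 0 / 4 \<le> sin y - y / 4"
  proof (rule DERIV_nonneg_imp_nondecreasing[OF assms(1)])
    fix x assume x: "0 \<le> x" "x \<le> y"
    have "cos x \<ge> cos (pi / 3)" using x True by (intro cos_monotone_0_pi_le) auto
    then have "cos x - 1 / 4 \<ge> 0" by (simp add: cos_60)
    moreover have "((\<lambda>y. sin y - y / 4) has_real_derivative cos x - 1 / 4) (at x)"
      by (auto intro!: derivative_eq_intros)
    ultimately show "\<exists>z. ((\<lambda>y. sin y - y / 4) has_real_derivative z) (at x) \<and> 0 \<le> z" by blast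
  qed
  then show ?thesis by simp
next
  case False
  have "sin y \<ge> sin (pi / 3)" using False assms by (intro sin_monotone_2pi_le) auto
  moreover have "sqrt 3 \<ge> (1::real)" by simp
  ultimately have "sin y \<ge> 1 / 2" unfolding sin_60 by linarith
  then show ?thesis using assms pi_less_4 by linarith
qed

text \<open>The squared norm is (1 - r)^2 + 2 r (1 + cos t), which for r >= 1/2 is at least (1 + cos
  t) / 2 = sin^2 (|t - pi| / 2). The bound depends on the angle only, hence is uniform in the
  radius.\<close>

lemma norm_one_plus_rcis_ge:
  assumes "1 / 2 \<le> r" "r \<le> 1" "0 \<le> t" "t \<le> 2 * pi"
  shows "\<bar>t - pi\<bar> / 8 \<le> norm (1 + of_real r * cis t)"
proof -
  have "\<bar>t - pi\<bar> / 8 \<le> sin (\<bar>t - pi\<bar> / 2)"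
    using sin_lower_bound[of "\<bar>t - pi\<bar> / 2"] assms by (auto simp: abs_if)
  then have "(\<bar>t - pi\<bar> / 8)\<^sup>2 \<le> (sin (\<bar>t - pi\<bar> / 2))\<^sup>2"
    by (intro power_mono) auto
  also have "\<dots> = (1 - cos \<bar>t - pi\<bar>) / 2"
    using cos_double_sin[of "\<bar>t - pi\<bar> / 2"] by simp
  also have "cos \<bar>t - pi\<bar> = - cos t" by (simp add: cos_diff)
  also have "(1 - - cos t) / 2 \<le> (1 - r)\<^sup>2 + 2 * r * (1 + cos t)"
  proof -
    have "(1 / 2) * (1 + cos t) \<le> 2 * r * (1 + cos t)"
      using assms cos_ge_minus_one[of t] by (intro mult_right_mono) linarith+
    then show ?thesis by (simp add: add_increasing)
  qed
  also have "\<dots> = (norm (1 + of_real r * cis t))\<^sup>2"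
  proof -
    have "(norm (1 + of_real r * cis t))\<^sup>2 = (1 + r * cos t)\<^sup>2 + (r * sin t)\<^sup>2"
      by (simp add: cmod_power2)
    also have "\<dots> = 1 + 2 * r * cos t + r\<^sup>2 * ((sin t)\<^sup>2 + (cos t)\<^sup>2)" by algebra
    also have "\<dots> = (1 - r)\<^sup>2 + 2 * r * (1 + cos t)"
      by (simp add: power2_eq_square algebra_simps)
    finally show ?thesis by simp
  qed
  finally show ?thesis by (rule power2_le_imp_le) simp
qed

lemma integrable_inverse_sqrt_dist:
  "(\<lambda>t. \<bar>t - pi\<bar> powr (- 1 / 2)) integrable_on {0..2 * pi}"
proof -
  have 1: "(\<lambda>t::real. \<bar>t\<bar> powr (- 1 / 2)) integrable_on {0..pi}"
    using has_integral_powr_from_0[of "- 1 / 2" pi]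
    by (intro integrable_spike_finite[of "{}", OF _ _ has_integral_integrable]) auto
  have 2: "(\<lambda>t::real. \<bar>t\<bar> powr (- 1 / 2)) integrable_on {- pi..0}"
    using Henstock_Kurzweil_Integration.integrable_reflect_real[where f = "\<lambda>t::real. \<bar>t\<bar> powr (- 1 / 2)" and a = "- pi" and b = 0] 1
    by simp
  have "(\<lambda>t::real. \<bar>t\<bar> powr (- 1 / 2)) integrable_on {- pi..pi}"
    by (rule Henstock_Kurzweil_Integration.integrable_combine[OF _ _ 2 1]) auto
  moreover have "(\<lambda>t::real. \<bar>t\<bar> powr (- 1 / 2)) = (\<lambda>t. \<bar>t - pi\<bar> powr (- 1 / 2)) \<circ> (+) pi"
    by (auto simp: fun_eq_iff)
  ultimately show ?thesis
    using integrable_on_shift_Icc_real[of "\<lambda>t. \<bar>t - pi\<bar> powr (- 1 / 2)" pi "- pi" pi] by simp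
qed

lemma norm_cis_minus_one_le: "norm (cis t - 1) \<le> \<bar>t\<bar>"
  using dist_exp_i_1[of t] abs_sin_x_le_abs_x[of "t / 2"] by (simp add: cis_conv_exp)

text \<open>The coefficient of order \<open>m\<close> of \<open>h z - h (cis (pi / m) * z)\<close> is
  twice that of \<open>h\<close>.\<close>
lemma taylor_coeff_rotation_bound:
  assumes holo: "h holomorphic_on ball 0 1" and m: "m > 0" and r: "0 < r" "r < 1"
  defines "f \<equiv> \<lambda>t. norm (h (of_real r * cis t) - h (cis (pi / m) * (of_real r * cis t)))"
  shows "f integrable_on {0..2 * pi}"
    and "4 * pi * norm ((deriv ^^ m) h 0 / fact m) * r ^ m \<le> integral {0..2 * pi} f"
proof -
  define c where "c = cis (pi / m)"
  define g where "g = (\<lambda>z. h z - h (c * z))"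
  have c: "norm c = 1" "c ^ m = -1" using m by (simp_all add: c_def Complex.DeMoivre)
  have hc: "(\<lambda>z. h (c * z)) holomorphic_on ball 0 1"
    by (rule holomorphic_on_compose_gen[OF _ holo, unfolded o_def])
      (auto intro!: holomorphic_intros simp: norm_mult c)
  have g: "g holomorphic_on ball 0 1"
    unfolding g_def by (intro holomorphic_intros holo hc)
  have sub: "cball (0::complex) r \<subseteq> ball 0 1" using r by auto
  have "(deriv ^^ m) g 0 = (deriv ^^ m) h 0 - (deriv ^^ m) (\<lambda>z. h (c * z)) 0"
    unfolding g_def by (rule higher_deriv_diff[OF holo hc]) auto
  also have "(deriv ^^ m) (\<lambda>z. h (c * z)) 0 = c ^ m * (deriv ^^ m) h (c * 0)"
    by (rule higher_deriv_compose_linear[OF holo, of "ball 0 1"]) (auto simp: norm_mult c)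
  finally have coeff: "(deriv ^^ m) g 0 = 2 * (deriv ^^ m) h 0" by (simp add: c)
  have f_eq: "f = (\<lambda>t. norm (g (of_real r * cis t)))" by (simp add: f_def g_def c_def)
  have "continuous_on {0..2 * pi} f"
    unfolding f_eq
    by (intro continuous_on_norm continuous_on_compose2[OF holomorphic_on_imp_continuous_on[OF g]]
        continuous_intros) (use r in \<open>auto simp: norm_mult\<close>)
  then show int: "f integrable_on {0..2 * pi}" by (rule integrable_continuous_interval)
  define I where "I = 2 * pi * \<i> / fact m * (deriv ^^ m) g 0"
  have "((\<lambda>u. g u / (u - 0) ^ Suc m) has_contour_integral I) (circlepath 0 r)"
    unfolding I_def
    by (rule Cauchy_has_contour_integral_higher_derivative_circlepath)
      (use g sub r in \<open>auto intro: holomorphic_on_imp_continuous_on holomorphic_on_subset\<close>)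
  then have hi: "((\<lambda>t. g (of_real r * cis t) / (of_real r * cis t) ^ Suc m * r * \<i> * cis t) has_integral I) {0..2 * pi}"
    unfolding circlepath_def by (subst (asm) has_contour_integral_part_circlepath_iff) auto
  have "norm I \<le> integral {0..2 * pi} (\<lambda>t. f t * (1 / r ^ m))"
    unfolding integral_unique[OF hi, symmetric]
  proof (rule integral_norm_bound_integral)
    show "(\<lambda>t. f t * (1 / r ^ m)) integrable_on {0..2 * pi}"
      by (rule integrable_on_mult_left[OF int])
    show "norm (g (of_real r * cis t) / (of_real r * cis t) ^ Suc m * r * \<i> * cis t) \<le> f t * (1 / r ^ m)" for t
      using r by (simp add: f_eq norm_mult norm_divide norm_power)
  qed (use hi in auto)
  also have "\<dots> = integral {0..2 * pi} f * (1 / r ^ m)" by (rule integral_mult_left)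
  finally have "norm I * r ^ m \<le> integral {0..2 * pi} f" using r by (simp add: field_simps)
  moreover have "norm I = 4 * pi * norm ((deriv ^^ m) h 0 / fact m)"
    by (simp add: I_def coeff norm_mult norm_divide)
  ultimately show "4 * pi * norm ((deriv ^^ m) h 0 / fact m) * r ^ m \<le> integral {0..2 * pi} f" by simp
qed

text \<open>On the circle of radius 1 - 1/m the factor r^m in the coefficient bound stays away from
  0, so dividing by it costs a bounded factor.\<close>

lemma inverse_power_radius_bound:
  assumes "m \<ge> 2"
  shows "1 / (1 - 1 / real m) ^ m \<le> exp 2"
proof -
  have "1 / (1 - 1 / real m) = 1 + 1 / (real m - 1)" using assms by (simp add: field_simps)
  also have "\<dots> \<le> exp (1 / (real m - 1))" by (rule exp_ge_add_one_self)
  finally have "(1 / (1 - 1 / real m)) ^ m \<le> exp (1 / (real m - 1)) ^ m"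
    using assms by (intro power_mono) auto
  also have "\<dots> = exp (real m / (real m - 1))" by (simp flip: exp_of_nat_mult)
  also have "\<dots> \<le> exp 2" using assms by (simp add: field_simps)
  finally show ?thesis by (simp add: power_divide)
qed

text \<open>A Riemann--Lebesgue argument. On the circle of radius \<open>1 - 1/m\<close> the rotation by
  \<open>pi / m\<close> changes the distance to \<open>-1\<close> by a bounded factor only, which gives
  an integrable majorant independent of \<open>m\<close>.\<close>
theorem taylor_coeffs_tendsto_0:
  fixes h :: "complex \<Rightarrow> complex"
  assumes holo: "h holomorphic_on - {-1}"
    and bound: "\<And>z. norm z < 1 \<Longrightarrow> norm (h z) \<le> C * norm (1 + z) powr (- 1 / 2)" and C: "C \<ge> 0"
  shows "(\<lambda>n. (deriv ^^ n) h 0 / fact n) \<longlonglongrightarrow> 0"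
proof -
  \<comment> \<open>The shift by 2 keeps the radii at least 1/2.\<close>
  define m :: "nat \<Rightarrow> nat" where "m = (\<lambda>n. n + 2)"
  define r where "r = (\<lambda>n. 1 - 1 / real (m n))"
  define c where "c = (\<lambda>n. cis (pi / real (m n)))"
  define f where "f = (\<lambda>n t. norm (h (of_real (r n) * cis t) - h (c n * (of_real (r n) * cis t))))"
  \<comment> \<open>The majorant is 0 at t = pi because \<open>0 powr x\<close> is 0, so the
    integrand is set to 0 at this single point.\<close>
  define f0 where "f0 = (\<lambda>n t. if t = pi then 0 else f n t)"
  have r: "1 / 2 \<le> r n" "0 < r n" "r n < 1" for n by (auto simp: r_def m_def field_simps)
  have holo': "h holomorphic_on ball 0 1" using holo by (rule holomorphic_on_subset) auto
  have f_int: "f n integrable_on {0..2 * pi}" for n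
    using taylor_coeff_rotation_bound(1)[OF holo', of "m n" "r n"] r[of n]
    by (simp add: f_def c_def m_def)
  have f0_int: "f0 n integrable_on {0..2 * pi}" for n
    by (rule integrable_spike_finite[OF _ _ f_int[of n], of "{pi}"]) (auto simp: f0_def)
  have f0_eq: "integral {0..2 * pi} (f0 n) = integral {0..2 * pi} (f n)" for n
    by (rule integral_spike[of "{pi}"]) (auto simp: f0_def)
  have dom: "norm (f0 n t) \<le> 12 * C * \<bar>t - pi\<bar> powr (- 1 / 2)" if t: "t \<in> {0..2 * pi}" for n t
  proof (cases "t = pi")
    case True
    then show ?thesis by (simp add: f0_def)
  next
    case False
    define u where "u = of_real (r n) * cis t"
    have u: "norm u < 1" "norm (c n * u) < 1" using r[of n] by (auto simp: u_def c_def norm_mult)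
    have low: "\<bar>t - pi\<bar> / 8 \<le> norm (1 + u)"
      unfolding u_def using t r[of n] by (intro norm_one_plus_rcis_ge) auto
    have "norm (1 + u) \<le> norm (1 + c n * u) + norm (u - c n * u)"
      using norm_triangle_ineq[of "1 + c n * u" "u - c n * u"] by simp
    also have "norm (u - c n * u) = norm (c n - 1) * norm u"
      by (metis left_diff_distrib' mult_1 norm_minus_commute norm_mult)
    also have "\<dots> \<le> pi / m n * 1"
      using u norm_cis_minus_one_le[of "pi / m n"] by (intro mult_mono) (auto simp: c_def)
    \<comment> \<open>The rotation moves u by at most 4 times the distance of the circle to the unit
      circle, and that distance is at most |1 + c n * u|; hence the factor 5 below.\<close>
    also have "\<dots> \<le> 4 * (1 - r n)" using pi_less_4 by (simp add: r_def divide_right_mono)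
    also have "1 - r n \<le> norm (1 + c n * u)"
      using norm_triangle_ineq4[of "1 + c n * u" "c n * u"] r[of n] by (simp add: u_def c_def norm_mult)
    finally have "norm (1 + u) / 5 \<le> norm (1 + c n * u)" by simp
    then have low': "\<bar>t - pi\<bar> / 40 \<le> norm (1 + c n * u)" using low by simp
    have pos: "\<bar>t - pi\<bar> > 0" using False by simp
    \<comment> \<open>Here b is an integer upper bound for a square root: 3 for sqrt 8 and 7 for
      sqrt 40.\<close>
    have key: "norm (h v) \<le> C * (b * \<bar>t - pi\<bar> powr (- 1 / 2))"
      if v: "norm v < 1" "\<bar>t - pi\<bar> / b\<^sup>2 \<le> norm (1 + v)" and b: "b > 0" for v b
    proof -
      have "norm (h v) \<le> C * norm (1 + v) powr (- 1 / 2)" using v by (intro bound)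
      also have "\<dots> \<le> C * (\<bar>t - pi\<bar> / b\<^sup>2) powr (- 1 / 2)"
        using v b pos C by (intro mult_left_mono powr_mono2') auto
      also have "(\<bar>t - pi\<bar> / b\<^sup>2) powr (- 1 / 2) = b * \<bar>t - pi\<bar> powr (- 1 / 2)"
        using b pos by (simp add: powr_divide powr_minus powr_half_sqrt field_simps)
      finally show ?thesis .
    qed
    have "norm (h u) \<le> C * (3 * \<bar>t - pi\<bar> powr (- 1 / 2))"
      using low u by (intro key) auto
    moreover have "norm (h (c n * u)) \<le> C * (7 * \<bar>t - pi\<bar> powr (- 1 / 2))"
      using low' u by (intro key) auto
    ultimately have "f n t \<le> 10 * C * \<bar>t - pi\<bar> powr (- 1 / 2)"
      using norm_triangle_ineq4[of "h u" "h (c n * u)"] by (simp add: f_def u_def algebra_simps)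
    also have "\<dots> \<le> 12 * C * \<bar>t - pi\<bar> powr (- 1 / 2)"
      using C by (intro mult_right_mono) auto
    finally show ?thesis using False by (simp add: f0_def f_def)
  qed
  have r_lim: "r \<longlonglongrightarrow> 1" unfolding r_def m_def by real_asymp
  have "(\<lambda>n. pi / real (m n)) \<longlonglongrightarrow> 0" unfolding m_def by real_asymp
  then have "c \<longlonglongrightarrow> cis 0" unfolding c_def by (rule tendsto_cis)
  then have c_lim: "c \<longlonglongrightarrow> 1" by simp
  have lim: "(\<lambda>n. f0 n t) \<longlonglongrightarrow> 0" if t: "t \<in> {0..2 * pi}" for t
  proof (cases "t = pi")
    case True
    then show ?thesis by (simp add: f0_def)
  next
    case False
    have "cis t \<noteq> -1"
    proof
      assume "cis t = -1"
      then have "1 + complex_of_real 1 * cis t = 0" by simp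
      then show False using norm_one_plus_rcis_ge[of 1 t] t False by simp
    qed
    then have cont: "isCont h (cis t)"
      using holomorphic_on_imp_continuous_on[OF holo]
      by (simp add: continuous_on_eq_continuous_at open_Compl)
    have "(\<lambda>n. of_real (r n) * cis t) \<longlonglongrightarrow> of_real 1 * cis t"
      by (intro tendsto_intros r_lim)
    then have 1: "(\<lambda>n. of_real (r n) * cis t) \<longlonglongrightarrow> cis t" by simp
    then have "(\<lambda>n. c n * (of_real (r n) * cis t)) \<longlonglongrightarrow> 1 * cis t" by (intro tendsto_mult c_lim)
    then have 2: "(\<lambda>n. c n * (of_real (r n) * cis t)) \<longlonglongrightarrow> cis t" by simp
    have "(\<lambda>n. f n t) \<longlonglongrightarrow> norm (h (cis t) - h (cis t))"
      unfolding f_def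
      by (intro tendsto_intros isCont_tendsto_compose[OF cont] 1 2)
    then show ?thesis using False by (simp add: f0_def)
  qed
  have "(\<lambda>n. integral {0..2 * pi} (f0 n)) \<longlonglongrightarrow> integral {0..2 * pi} (\<lambda>t. 0 :: real)"
  proof (rule dominated_convergence(2))
    show "(\<lambda>t. 12 * C * \<bar>t - pi\<bar> powr (- 1 / 2)) integrable_on {0..2 * pi}"
      by (intro integrable_on_mult_right integrable_inverse_sqrt_dist)
  qed (use f0_int dom lim in auto)
  then have int0: "(\<lambda>n. integral {0..2 * pi} (f n)) \<longlonglongrightarrow> 0" by (simp add: f0_eq)
  have "(\<lambda>n. (deriv ^^ m n) h 0 / fact (m n)) \<longlonglongrightarrow> 0"
  proof (rule Lim_null_comparison)
    show "(\<lambda>n. integral {0..2 * pi} (f n) * exp 2) \<longlonglongrightarrow> 0"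
      using tendsto_mult_left_zero[OF int0] by simp
    show "\<forall>\<^sub>F n in sequentially. norm ((deriv ^^ m n) h 0 / fact (m n)) \<le> integral {0..2 * pi} (f n) * exp 2"
    proof (rule always_eventually, rule allI)
      fix n
      define a where "a = norm ((deriv ^^ m n) h 0 / fact (m n))"
      have a: "4 * pi * a * r n ^ m n \<le> integral {0..2 * pi} (f n)"
        using taylor_coeff_rotation_bound(2)[OF holo', of "m n" "r n"] r[of n]
        by (simp add: f_def c_def m_def a_def)
      have "a * r n ^ m n \<le> 4 * pi * (a * r n ^ m n)"
        using r[of n] pi_ge_two mult_right_mono[of 1 "4 * pi" "a * r n ^ m n"] by (simp add: a_def)
      with a have le: "a * r n ^ m n \<le> integral {0..2 * pi} (f n)" by (simp add: mult_ac)
      have "a = a * r n ^ m n * (1 / r n ^ m n)" using r[of n] by simp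
      also have "\<dots> \<le> integral {0..2 * pi} (f n) * exp 2"
        using le r[of n] inverse_power_radius_bound[of "m n"]
        by (intro mult_mono order_trans[OF _ le]) (auto simp: r_def m_def a_def)
      finally show "norm ((deriv ^^ m n) h 0 / fact (m n)) \<le> integral {0..2 * pi} (f n) * exp 2"
        by (simp add: a_def)
    qed
  qed
  then show ?thesis unfolding m_def by (rule LIMSEQ_offset)
qed


section \<open>The expansion on the critical line\<close>

lemma disc_function_boundary:
  assumes F: "\<And>s. s \<noteq> 1 \<Longrightarrow> F s = (s - 1) * zeta s" and s: "s \<noteq> 0" "s \<noteq> 1"
  shows "disc_function F k ((1 - s) / s) = ((1 - s) / s * zeta s) ^ k"
proof -
  have "1 + (1 - s) / s = 1 / s" using s by (simp add: field_simps)
  then have "- (1 + (1 - s) / s) * F (1 / (1 + (1 - s) / s)) = - (1 / s) * ((s - 1) * zeta s)"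
    using s by (simp add: F)
  also have "\<dots> = (1 - s) / s * zeta s" using s by (simp add: field_simps)
  finally show ?thesis unfolding disc_function_def by simp
qed

text \<open>With w = 1 + z, the condition |z| <= 1 says |w|^2 <= 2 Re w, and Re (1 / w) = Re w /
  |w|^2.\<close>

lemma Re_inverse_one_plus_ge:
  assumes "norm z \<le> 1" "z \<noteq> -1"
  shows "1 / 2 \<le> Re (1 / (1 + z))"
proof -
  have nz: "1 + z \<noteq> 0" using assms by (auto simp: add_eq_0_iff)
  have "(norm z)\<^sup>2 \<le> 1" using assms by (simp add: power_le_one)
  then have "(norm (1 + z))\<^sup>2 \<le> 2 * Re (1 + z)"
    unfolding cmod_power2 by (simp add: power2_eq_square algebra_simps)
  moreover have "(norm (1 + z))\<^sup>2 > 0" using nz by simp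
  ultimately have "1 / 2 \<le> Re (1 + z) / (norm (1 + z))\<^sup>2" by (simp add: field_simps)
  moreover have "Re (1 / (1 + z)) = Re (1 + z) / (norm (1 + z))\<^sup>2"
    by (simp add: Re_divide cmod_power2)
  ultimately show ?thesis by simp
qed

lemma Re_inverse_one_plus_eq:
  assumes "norm z = 1" "z \<noteq> -1"
  shows "Re (1 / (1 + z)) = 1 / 2"
proof -
  have nz: "1 + z \<noteq> 0" using assms by (auto simp: add_eq_0_iff)
  have "(norm (1 + z))\<^sup>2 = 1 + 2 * Re z + (norm z)\<^sup>2"
    unfolding cmod_power2 by (simp add: power2_eq_square algebra_simps)
  then have eq: "(norm (1 + z))\<^sup>2 = 2 * Re (1 + z)" using assms by simp
  moreover have "(norm (1 + z))\<^sup>2 > 0" using nz by simp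
  ultimately have "Re (1 + z) > 0" by linarith
  then have "Re (1 + z) / (norm (1 + z))\<^sup>2 = 1 / 2" unfolding eq by (subst nonzero_divide_eq_eq) auto
  moreover have "Re (1 / (1 + z)) = Re (1 + z) / (norm (1 + z))\<^sup>2"
    by (simp add: Re_divide cmod_power2)
  ultimately show ?thesis by (rule trans[rotated])
qed

section \<open>Consequences of the Lindelof Hypothesis in the disc\<close>

lemma lindelof_power_bound:
  assumes lindelof_hypothesis "k \<ge> 1"
  obtains B where "B \<ge> 0" "\<And>s. Re s = 1 / 2 \<Longrightarrow> norm (zeta s) ^ (2 * k) \<le> B * norm s"
proof -
  \<comment> \<open>The power 2 k then turns |t| powr \<epsilon> into |t| itself.\<close>
  define \<epsilon> where "\<epsilon> = 1 / real (2 * k)"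
  have \<epsilon>: "\<epsilon> > 0" using assms by (simp add: \<epsilon>_def)
  obtain C T where CT: "\<And>t. \<bar>t\<bar> \<ge> T \<Longrightarrow> norm (zeta (Complex (1/2) t)) \<le> C * \<bar>t\<bar> powr \<epsilon>"
    using assms(1) \<epsilon> unfolding lindelof_hypothesis_def by meson
  define T' where "T' = max T 1"
  have "continuous_on {- T'..T'} (\<lambda>t. zeta (Complex (1/2) t))"
    by (rule continuous_on_compose2[OF holomorphic_on_imp_continuous_on[OF zeta_holomorphic]])
      (auto simp: Complex_eq complex_eq_iff intro!: continuous_intros)
  then have "bounded ((\<lambda>t. zeta (Complex (1/2) t)) ` {- T'..T'})"
    by (intro compact_imp_bounded compact_continuous_image) auto
  then obtain Z where Z: "\<And>t. \<bar>t\<bar> \<le> T' \<Longrightarrow> norm (zeta (Complex (1/2) t)) \<le> Z"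
    unfolding bounded_iff by (metis abs_le_iff atLeastAtMost_iff image_eqI minus_le_iff)
  show ?thesis
  proof (rule that)
    show "0 \<le> \<bar>C\<bar> ^ (2 * k) + 2 * \<bar>Z\<bar> ^ (2 * k)" by simp
    fix s assume s: "Re s = 1 / 2"
    define t where "t = Im s"
    have s_eq: "s = Complex (1/2) t" using s by (simp add: t_def complex_eq_iff)
    have ns: "\<bar>t\<bar> \<le> norm s" "1 / 2 \<le> norm s"
      using abs_Im_le_cmod[of s] complex_Re_le_cmod[of s] s by (auto simp: t_def)
    show "norm (zeta s) ^ (2 * k) \<le> (\<bar>C\<bar> ^ (2 * k) + 2 * \<bar>Z\<bar> ^ (2 * k)) * norm s"
    proof (cases "\<bar>t\<bar> \<le> T'")
      case True
      have "norm (zeta s) ^ (2 * k) \<le> \<bar>Z\<bar> ^ (2 * k) * 1"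
        using Z[OF True] by (simp add: s_eq) (intro power_mono, auto)
      \<comment> \<open>On the critical line |s| >= 1/2, so a constant is absorbed into a multiple
        of |s|.\<close>
      also have "\<dots> \<le> \<bar>Z\<bar> ^ (2 * k) * (2 * norm s)"
        using ns by (intro mult_left_mono) auto
      also have "\<dots> \<le> (\<bar>C\<bar> ^ (2 * k) + 2 * \<bar>Z\<bar> ^ (2 * k)) * norm s"
        by (simp add: distrib_right)
      finally show ?thesis .
    next
      case False
      then have t: "\<bar>t\<bar> \<ge> T" "\<bar>t\<bar> > 0" by (auto simp: T'_def)
      have "norm (zeta s) \<le> \<bar>C\<bar> * \<bar>t\<bar> powr \<epsilon>"
        using CT[OF t(1)] by (simp add: s_eq) (smt (verit) mult_right_mono powr_ge_zero)
      then have "norm (zeta s) ^ (2 * k) \<le> (\<bar>C\<bar> * \<bar>t\<bar> powr \<epsilon>) ^ (2 * k)"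
        by (intro power_mono) auto
      also have "\<dots> = \<bar>C\<bar> ^ (2 * k) * (\<bar>t\<bar> powr \<epsilon>) ^ (2 * k)" by (rule power_mult_distrib)
      also have "(\<bar>t\<bar> powr \<epsilon>) ^ (2 * k) = \<bar>t\<bar> powr (real (2 * k) * \<epsilon>)"
        using t by (subst powr_realpow[symmetric]) (auto simp: powr_powr mult.commute)
      also have "real (2 * k) * \<epsilon> = 1" using assms by (simp add: \<epsilon>_def)
      also have "\<bar>t\<bar> powr 1 = \<bar>t\<bar>" by simp
      also have "\<bar>C\<bar> ^ (2 * k) * \<bar>t\<bar> \<le> (\<bar>C\<bar> ^ (2 * k) + 2 * \<bar>Z\<bar> ^ (2 * k)) * norm s"
        using ns by (intro mult_mono) auto
      finally show ?thesis .
    qed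
  qed
qed

text \<open>Multiplying the square of the function by 1 + z = 1 / s gives modulus |zeta s|^(2 k) /
  |s| on the circle, which is bounded. Phragmen--Lindelof carries this bound into the disc, and a
  square root of moduli yields the exponent -1/2 without choosing a branch.\<close>

lemma lindelof_disc_function_bound:
  assumes LH: lindelof_hypothesis and k: "k \<ge> 1"
    and F: "F holomorphic_on UNIV" "\<And>s. s \<noteq> 1 \<Longrightarrow> F s = (s - 1) * zeta s"
    and growth: "\<And>s. Re s \<ge> 1/2 \<Longrightarrow> norm (F s) \<le> A * (1 + norm s)\<^sup>2" and A: "A \<ge> 0"
  obtains C where "C \<ge> 0"
    "\<And>z. norm z < 1 \<Longrightarrow> norm (disc_function F k z) \<le> C * norm (1 + z) powr (- 1 / 2)"
proof -
  obtain B where B: "B \<ge> 0" "\<And>s. Re s = 1 / 2 \<Longrightarrow> norm (zeta s) ^ (2 * k) \<le> B * norm s"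
    using lindelof_power_bound[OF LH k] by blast
  define q where "q = (\<lambda>z. disc_function F k z ^ 2 * (1 + z))"
  have norm_q: "norm (q z) = (norm (1 + z) * norm (F (1 / (1 + z)))) ^ (2 * k) * norm (1 + z)" for z
    unfolding q_def disc_function_def norm_mult norm_power norm_minus_cancel
    by (simp only: power_mult[symmetric] mult.commute[of k])
  have nz: "1 + z \<noteq> 0" if "z \<noteq> -1" for z :: complex using that by (auto simp: add_eq_0_iff)
  have q_bound: "norm (q z) \<le> B" if "norm z \<le> 1" "z \<noteq> -1" for z
  proof (rule phragmen_lindelof_disc[OF _ _ _ B(1) that])
    show "q holomorphic_on - {-1}"
      unfolding q_def by (intro holomorphic_intros disc_function_holomorphic F)
  next
    fix z :: complex assume z: "norm z \<le> 1" "z \<noteq> -1"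
    define w where "w = norm (1 + z)"
    have w: "0 < w" "w \<le> 2" using nz[OF z(2)] z norm_triangle_ineq[of 1 z] by (auto simp: w_def)
    have "norm (F (1 / (1 + z))) \<le> A * (1 + norm (1 / (1 + z)))\<^sup>2"
      by (rule growth[OF Re_inverse_one_plus_ge[OF z]])
    \<comment> \<open>Since w <= 2, 1 + 1 / w is at most 3 / w.\<close>
    also have "\<dots> \<le> A * (3 / w)\<^sup>2"
      using w A
      by (intro mult_left_mono power_mono) (auto simp: norm_divide w_def[symmetric] field_simps)
    finally have "w * norm (F (1 / (1 + z))) * w \<le> w * (A * (3 / w)\<^sup>2) * w"
      using w by (intro mult_right_mono mult_left_mono) auto
    also have "\<dots> = 9 * A" using w by (simp add: power2_eq_square)
    finally have le: "w * norm (F (1 / (1 + z))) * w \<le> 9 * A" .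
    have "norm (q z) * w ^ (2 * k) = (w * norm (F (1 / (1 + z))) * w) ^ (2 * k) * w"
      unfolding norm_q w_def[symmetric] by (simp add: power_mult_distrib)
    also have "\<dots> \<le> (9 * A) ^ (2 * k) * 2"
      using w A by (intro mult_mono power_mono[OF le]) auto
    finally show "norm (q z) * norm (1 + z) ^ (2 * k) \<le> (9 * A) ^ (2 * k) * 2"
      by (simp add: w_def)
  next
    fix z :: complex assume z: "norm z = 1" "z \<noteq> -1"
    define s where "s = 1 / (1 + z)"
    have s: "Re s = 1 / 2" unfolding s_def by (rule Re_inverse_one_plus_eq[OF z])
    then have "s \<noteq> 1" by auto
    have "norm (1 + z) * norm (F s) = norm (z * zeta s)"
    proof -
      have "(1 + z) * F s = - z * zeta s"
        using nz[OF z(2)] by (simp add: F(2)[OF \<open>s \<noteq> 1\<close>]) (simp add: s_def field_simps)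
      then show ?thesis by (metis norm_minus_cancel norm_mult mult_minus_left)
    qed
    then have "norm (q z) = norm (zeta s) ^ (2 * k) * norm (1 + z)"
      using z by (simp add: norm_q s_def norm_mult)
    also have "\<dots> \<le> B * norm s * norm (1 + z)" by (intro mult_right_mono B s) auto
    also have "\<dots> = B" using nz[OF z(2)] by (simp add: s_def norm_divide)
    finally show "norm (q z) \<le> B" .
  qed
  show ?thesis
  proof (rule that)
    show "0 \<le> sqrt B" using B by simp
    fix z :: complex assume z: "norm z < 1"
    then have z': "z \<noteq> -1" by auto
    have w: "norm (1 + z) > 0" using nz[OF z'] by simp
    have "(norm (disc_function F k z))\<^sup>2 * norm (1 + z) \<le> B"
      using q_bound[of z] z z' by (simp add: q_def norm_mult norm_power)
    then have "(norm (disc_function F k z))\<^sup>2 \<le> B / norm (1 + z)" using w by (simp add: field_simps)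
    then have "norm (disc_function F k z) \<le> sqrt (B / norm (1 + z))" by (rule real_le_rsqrt)
    also have "\<dots> = sqrt B * (1 / sqrt (norm (1 + z)))" by (simp add: real_sqrt_divide)
    also have "1 / sqrt (norm (1 + z)) = norm (1 + z) powr (- 1 / 2)"
      using powr_minus_divide[of "norm (1 + z)" "1 / 2"] powr_half_sqrt[of "norm (1 + z)"] by simp
    finally show "norm (disc_function F k z) \<le> sqrt B * norm (1 + z) powr (- 1 / 2)" .
  qed
qed

text \<open>The critical line corresponds to the unit circle without -1, where the Fatou--Riesz
  theorem gives convergence to (z zeta(s))^k. Division by z^k shifts the summation range from n >= 0
  to n >= -k.\<close>

lemma zeta_expansion_if_ell_tendsto_0:
  assumes "(\<lambda>n. ell (int n) k) \<longlonglongrightarrow> 0"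
  shows "zeta_expansion_holds k t"
proof -
  obtain F where F: "F holomorphic_on UNIV" "\<And>s. s \<noteq> 1 \<Longrightarrow> F s = (s - 1) * zeta s"
    using zeta_pole_removed by metis
  define s where "s = Complex (1/2) t"
  define z where "z = Complex (1/2) (- t) / s"
  have s: "s \<noteq> 0" "s \<noteq> 1" and one_minus: "Complex (1/2) (- t) = 1 - s"
    by (auto simp: s_def complex_eq_iff)
  have z_eq: "z = (1 - s) / s" by (simp add: z_def one_minus)
  have boundary: "disc_function F k z = (z * zeta s) ^ k"
    unfolding z_eq using F(2) s by (rule disc_function_boundary)
  have "norm (1 - s) = norm s"
    unfolding one_minus[symmetric] by (simp add: s_def cmod_def)
  then have z: "norm z = 1" "z \<noteq> -1" "z \<noteq> 0"
    using s by (auto simp: z_eq norm_divide field_simps)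
  have "(\<lambda>n. ell (int (n + k) - int k) k) \<longlonglongrightarrow> 0" using assms by simp
  then have "(\<lambda>n. ell (int n - int k) k) \<longlonglongrightarrow> 0" by (rule LIMSEQ_offset)
  then have "(\<lambda>n. \<Sum>m\<le>n. ell (int m - int k) k * z ^ m) \<longlonglongrightarrow> disc_function F k z"
    by (intro fatou_riesz disc_function_holomorphic disc_function_sums F z) auto
  \<comment> \<open>The upper limit N + k becomes N after the shift by k.\<close>
  then have "(\<lambda>N. \<Sum>m\<le>N + k. ell (int m - int k) k * z ^ m) \<longlonglongrightarrow> (z * zeta s) ^ k"
    unfolding boundary by (rule LIMSEQ_ignore_initial_segment)
  then have "(\<lambda>N. (\<Sum>m\<le>N + k. ell (int m - int k) k * z ^ m) / z ^ k) \<longlonglongrightarrow> (z * zeta s) ^ k / z ^ k"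
    by (intro tendsto_divide tendsto_const) (use z in auto)
  moreover have "(\<Sum>n\<in>{- int k..int N}. ell n k * z powi n)
      = (\<Sum>m\<le>N + k. ell (int m - int k) k * z ^ m) / z ^ k" for N
    unfolding sum_divide_distrib
  proof (rule sum.reindex_bij_witness[of _ "\<lambda>m. int m - int k" "\<lambda>n. nat (n + int k)"])
    fix n assume n: "n \<in> {- int k..int N}"
    have "z powi n = z ^ nat (n + int k) / z ^ k"
    proof -
      have "z powi n = z powi (int (nat (n + int k)) - int k)" using n by simp
      also have "\<dots> = z ^ nat (n + int k) / z ^ k"
        using z by (simp only: power_int_diff power_int_of_nat simp_thms)
      finally show ?thesis .
    qed
    then show "ell (int (nat (n + int k)) - int k) k * z ^ nat (n + int k) / z ^ k = ell n k * z powi n"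
      using n by simp
  qed auto
  moreover have "(z * zeta s) ^ k / z ^ k = zeta s ^ k" using z by (simp add: power_mult_distrib)
  ultimately show ?thesis
    unfolding zeta_expansion_holds_def s_def[symmetric] z_def[symmetric] by simp
qed

text \<open>The numbers \<open>ell\<close>, with index shifted by k, are the Taylor coefficients of
  \<open>disc_function\<close>, whose blow-up at -1 is integrable under the hypothesis.\<close>

lemma lindelof_imp_ell_tendsto_0:
  assumes lindelof_hypothesis "k \<ge> 1"
  shows "(\<lambda>n. ell (int n) k) \<longlonglongrightarrow> 0"
proof -
  obtain F A where F: "F holomorphic_on UNIV" "\<And>s. s \<noteq> 1 \<Longrightarrow> F s = (s - 1) * zeta s"
    and A: "A \<ge> 0" "\<And>s. Re s \<ge> 1/2 \<Longrightarrow> norm (F s) \<le> A * (1 + norm s)\<^sup>2"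
    using zeta_pole_removed by metis
  obtain C where C: "C \<ge> 0"
    "\<And>z. norm z < 1 \<Longrightarrow> norm (disc_function F k z) \<le> C * norm (1 + z) powr (- 1 / 2)"
    using lindelof_disc_function_bound[OF assms F A(2) A(1)] by blast
  have "(\<lambda>n. (deriv ^^ n) (disc_function F k) 0 / fact n) \<longlonglongrightarrow> 0"
    by (rule taylor_coeffs_tendsto_0[OF disc_function_holomorphic[OF F(1)] C(2) C(1)])
  then have "(\<lambda>n. ell (int n - int k) k) \<longlonglongrightarrow> 0"
    using fps_nth_fps_expansion[OF disc_function_has_fps_expansion[OF F]] by simp
  from LIMSEQ_ignore_initial_segment[OF this, of k] show ?thesis by simp
qed

theorem theorem2:
  fixes k :: nat
  assumes "k \<ge> 1"
  shows "(summable (\<lambda>n::nat. (cmod (ell (int n) k))\<^sup>2) \<longrightarrow>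
            (\<forall>t::real. zeta_expansion_holds k t))
       \<and> (lindelof_hypothesis \<longrightarrow> (\<forall>t::real. zeta_expansion_holds k t))"
proof (intro conjI impI allI)
  fix t
  assume "summable (\<lambda>n::nat. (cmod (ell (int n) k))\<^sup>2)"
  then have "(\<lambda>n. (cmod (ell (int n) k))\<^sup>2) \<longlonglongrightarrow> 0" by (rule summable_LIMSEQ_zero)
  from tendsto_real_sqrt[OF this] have "(\<lambda>n. cmod (ell (int n) k)) \<longlonglongrightarrow> 0" by simp
  then have "(\<lambda>n. ell (int n) k) \<longlonglongrightarrow> 0" by (rule tendsto_norm_zero_cancel)
  then show "zeta_expansion_holds k t" by (rule zeta_expansion_if_ell_tendsto_0)
next
  fix t
  assume lindelof_hypothesis
  then show "zeta_expansion_holds k t"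
    using assms by (intro zeta_expansion_if_ell_tendsto_0 lindelof_imp_ell_tendsto_0)
qed

end
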